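(* Let $n\ge 1$ be an integer, let $X \in \mathrm{Proj}_{\mathbb{F}}(1,2n)$ and $\delta>0$ be fixed, and let $D\in\mathbb{R}$. If $m$ is a positive integer with $$m \ge \frac{14}{3}(\mu_1-\mu_2)^{-2}\delta^{-2}\bigl(\log(4n)+D\bigr),$$ and $\mathcal{P}=\{P_j\}_{j=1}^m$ is an independent sequence of uniformly distributed projections in $\mathrm{Proj}_{\mathbb{F}}(n,2n)$, then with probability at least $1-\exp(-D)$ $$\|\hat X - X\| < \delta,$$ where $\hat X$ is the solution to the Principal Eigenspace Program (PEP) with input $\Phi_{\mathcal{P}}(X)$.
   Context: $\mathbb{F}$ is either $\mathbb{R}$ or $\mathbb{C}$; $\beta=\frac12$ if $\mathbb{F}=\mathbb{R}$ and $\beta=1$ if $\mathbb{F}=\mathbb{C}$. $\mathrm{Proj}_{\mathbb{F}}(k,d)$ is the set of rank-$k$ orthogonal projections on $\mathbb{F}^d$; its uniform distribution is the unique probability measure invariant under conjugation by all orthogonal ($\mathbb{F}=\mathbb{R}$) or unitary ($\mathbb{F}=\mathbb{C}$) $d\times d$ matrices. $\|\cdot\|$ on matrices is the operator norm. The constants are $$\mu_1=\frac12+\frac{1}{\beta n\,4^{\beta n}B(\beta n,\beta n)},\qquad \mu_2=\frac12-\frac{1}{\beta n(2n-1)4^{\beta n}B(\beta n,\beta n)},$$ where $B(a,b)=\int_0^1 t^{a-1}(1-t)^{b-1}\,dt$ is the Beta function. For $P\in\mathrm{Proj}_{\mathbb{F}}(n,2n)$ and $X\in\mathrm{Proj}_{\mathbb{F}}(1,2n)$,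 $\phi_P(X)=1$ if $\mathrm{tr}(PX)\ge\frac12$ and $\phi_P(X)=0$ otherwise. For $\mathcal{P}=\{P_j\}_{j=1}^m$, the binary measurement map is $\Phi_{\mathcal{P}}(X)=(\phi_{P_j}(X))_{j=1}^m\in\{0,1\}^m$. (PEP) with input $b\in\{0,1\}^m$: put $Q_b=\frac1m\sum_{j=1}^m R_j$, where $R_j=P_j$ if $b_j=1$ and $R_j=I-P_j$ if $b_j=0$, and maximize $\mathrm{tr}(Q_bY)$ over positive semidefinite $Y\in\mathbb{F}^{2n\times 2n}$ with $\mathrm{tr}(Y)\le1$. The solution is taken to be a rank-one orthogonal projection onto a line in the eigenspace of the largest eigenvalue of $Q_b$; when that eigenvalue is simple (which happens with probability 1 in this random model) it is the unique solution, namely the orthogonal projection onto that eigenspace. *)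

theory Defs
  imports "HOL-Probability.Probability"
begin

section \<open>The scalar field\<close>

text \<open>
  This class describes exactly the fields \<open>\<real>\<close> and \<open>\<complex>\<close>: by \<open>real_or_complex_cases\<close> below,
  every instance is isometrically isomorphic, as a real algebra, to one of the two.
  On both, \<open>x \<bullet> y\<close> is the real part of \<open>x\<close> times the conjugate of \<open>y\<close>.
\<close>

class real_or_complex = real_normed_field + euclidean_space

instance real :: real_or_complex ..
instance complex :: real_or_complex ..

definition real_part :: "'a::real_or_complex \<Rightarrow> real" where
  "real_part x = x \<bullet> 1"

text \<open>Reflection in the line spanned by 1.\<close>

definition conjugate :: "'a::real_or_complex \<Rightarrow> 'a" where
  "conjugate x = of_real (2 * real_part x) - x"

definition beta_param :: "'a::real_or_complex itself \<Rightarrow> real" where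
  "beta_param _ = real DIM('a) / 2"

lemma real_part_real [simp]: "real_part (x :: real) = x"
  by (simp add: real_part_def)

lemma real_part_complex [simp]: "real_part z = Re z"
  by (simp add: real_part_def)

lemma conjugate_real [simp]: "conjugate (x :: real) = x"
  by (simp add: conjugate_def)

lemma conjugate_complex [simp]: "conjugate z = cnj z"
  by (simp add: conjugate_def complex_eq_iff)

lemma beta_param_real: "beta_param TYPE(real) = 1 / 2"
  by (simp add: beta_param_def)

lemma beta_param_complex: "beta_param TYPE(complex) = 1"
  by (simp add: beta_param_def)

lemma imag_unit_square:
  fixes x :: "'a::real_or_complex"
  assumes "x \<bullet> 1 = 0" "norm x = 1"
  shows "x * x = - 1"
proof -
  have 1: "(1::'a) \<bullet> 1 = 1" by (simp add: dot_square_norm)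
  have xx: "x \<bullet> x = 1" using assms by (simp add: dot_square_norm)
  have a: "(norm (1 + x))\<^sup>2 = 2" "(norm (1 - x))\<^sup>2 = 2"
    using assms(1) 1 xx by (simp_all add: power2_norm_eq_inner inner_simps inner_commute)
  have "(norm (1 - x * x))\<^sup>2 = (norm ((1 + x) * (1 - x)))\<^sup>2" by (simp add: algebra_simps)
  also have "\<dots> = 4" by (simp add: norm_mult power_mult_distrib a)
  finally have "(norm (1 - x * x))\<^sup>2 = 4" .
  moreover have "(x * x) \<bullet> (x * x) = 1" by (simp add: dot_square_norm norm_mult assms)
  ultimately have "(x * x) \<bullet> 1 = - 1"
    using 1 by (simp add: power2_norm_eq_inner inner_simps inner_commute)
  then have "(norm (x * x + 1))\<^sup>2 = 0"
    using 1 \<open>(x * x) \<bullet> (x * x) = 1\<close> by (simp add: power2_norm_eq_inner inner_simps inner_commute)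
  then show ?thesis by (simp add: eq_neg_iff_add_eq_0)
qed

lemma orthogonal_imag_unit_multiple:
  fixes i x :: "'a::real_or_complex"
  assumes i: "i \<bullet> 1 = 0" "norm i = 1"
  shows "x = (x \<bullet> 1) *\<^sub>R 1 + (x \<bullet> i) *\<^sub>R i"
proof (rule ccontr)
  define y where "y = x - (x \<bullet> 1) *\<^sub>R 1 - (x \<bullet> i) *\<^sub>R i"
  assume "\<not> ?thesis"
  then have "y \<noteq> 0" by (auto simp: y_def algebra_simps)
  have 1: "(1::'a) \<bullet> 1 = 1" "i \<bullet> i = 1" using i by (simp_all add: dot_square_norm)
  have y: "y \<bullet> 1 = 0" "y \<bullet> i = 0" using 1 i by (simp_all add: y_def inner_simps inner_commute)
  define u where "u = sgn y"
  have u: "u \<bullet> 1 = 0" "norm u = 1" "u \<bullet> i = 0"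
    using y \<open>y \<noteq> 0\<close> by (simp_all add: u_def sgn_div_norm norm_sgn)
  have "(u - i) * (u + i) = u * u - i * i" by (simp add: algebra_simps)
  then have "(u - i) * (u + i) = 0" using imag_unit_square[OF u(1,2)] imag_unit_square[OF i] by simp
  then have "u = i \<or> u = - i" by (simp add: eq_neg_iff_add_eq_0)
  then show False using u(3) 1 by auto
qed

lemma real_or_complex_cases:
  "(\<exists>f :: 'a::real_or_complex \<Rightarrow> real. bij f \<and> linear f \<and> f 1 = 1 \<and>
      (\<forall>x y. f (x * y) = f x * f y) \<and> (\<forall>x. norm (f x) = norm x) \<and>
      (\<forall>x. f x = real_part x) \<and> (\<forall>x::'a. conjugate x = x) \<and> beta_param TYPE('a) = 1 / 2)
 \<or> (\<exists>f :: 'a \<Rightarrow> complex. bij f \<and> linear f \<and> f 1 = 1 \<and>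
      (\<forall>x y. f (x * y) = f x * f y) \<and> (\<forall>x. norm (f x) = norm x) \<and>
      (\<forall>x. Re (f x) = real_part x) \<and> (\<forall>x. f (conjugate x) = cnj (f x)) \<and> beta_param TYPE('a) = 1)"
proof (cases "\<exists>i::'a. i \<bullet> 1 = 0 \<and> norm i = 1")
  case True
  then obtain i :: 'a where i: "i \<bullet> 1 = 0" "norm i = 1" by blast
  define f where "f = (\<lambda>x::'a. Complex (x \<bullet> 1) (x \<bullet> i))"
  have 1: "(1::'a) \<bullet> 1 = 1" "i \<bullet> i = 1" "1 \<bullet> i = 0"
    using i by (simp_all add: dot_square_norm inner_commute)
  have ii: "i * i = - 1" by (rule imag_unit_square[OF i])
  have rep: "x = (x \<bullet> 1) *\<^sub>R 1 + (x \<bullet> i) *\<^sub>R i" for x :: 'a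
    by (rule orthogonal_imag_unit_multiple[OF i])
  have f_rep: "f (a *\<^sub>R 1 + b *\<^sub>R i) = Complex a b" for a b
    using 1 i by (simp add: f_def inner_simps)
  have lin: "linear f"
    by (rule linearI) (simp_all add: f_def inner_simps complex_eq_iff)
  have bij: "bij f"
  proof (rule bijI)
    show "inj f" by (rule injI) (metis rep f_def complex.inject)
    show "surj f" by (rule surjI[where f = "\<lambda>z. Re z *\<^sub>R 1 + Im z *\<^sub>R i"]) (simp add: f_rep)
  qed
  have mult: "f (x * y) = f x * f y" for x y
  proof -
    have e: "(a *\<^sub>R 1 + b *\<^sub>R i) * (c *\<^sub>R 1 + d *\<^sub>R i) = (a * c - b * d) *\<^sub>R 1 + (a * d + b * c) *\<^sub>R i"
      for a b c d
      using ii by (simp add: algebra_simps)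
    show ?thesis
      by (subst rep[of x], subst rep[of y], subst e, subst f_rep)
        (simp add: f_def complex_eq_iff)
  qed
  have norm: "norm (f x) = norm x" for x
  proof -
    have e: "(norm (a *\<^sub>R 1 + b *\<^sub>R i))\<^sup>2 = a\<^sup>2 + b\<^sup>2" for a b
      unfolding power2_norm_eq_inner
      using 1 by (simp add: inner_simps power2_eq_square inner_commute)
    have "(norm x)\<^sup>2 = (x \<bullet> 1)\<^sup>2 + (x \<bullet> i)\<^sup>2" using e[of "x \<bullet> 1" "x \<bullet> i"] rep[of x] by simp
    then show ?thesis by (metis f_def cmod_def complex.sel norm_ge_zero real_sqrt_abs abs_of_nonneg)
  qed
  have cnj: "f (conjugate x) = cnj (f x)" for x
    using 1 by (simp add: conjugate_def real_part_def f_def of_real_def inner_simps complex_eq_iff)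
  have "dim (range f) = dim (UNIV :: 'a set)"
    by (rule dim_image_eq[OF lin]) (use bij in \<open>auto simp: bij_def inj_on_def\<close>)
  then have "DIM('a) = 2" using bij by (simp add: bij_def)
  then have beta: "beta_param TYPE('a) = 1" by (simp add: beta_param_def)
  show ?thesis
    by (intro disjI2 exI[of _ f]) (use bij lin mult norm cnj beta 1 in
        \<open>auto simp: f_def real_part_def complex_eq_iff\<close>)
next
  case False
  define f where "f = (\<lambda>x::'a. x \<bullet> 1)"
  have 1: "(1::'a) \<bullet> 1 = 1" by (simp add: dot_square_norm)
  have rep: "x = (x \<bullet> 1) *\<^sub>R 1" for x :: 'a
  proof (rule ccontr)
    define y where "y = x - (x \<bullet> 1) *\<^sub>R 1"
    assume "\<not> ?thesis"
    then have "y \<noteq> 0" by (simp add: y_def)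
    moreover have "y \<bullet> 1 = 0" using 1 by (simp add: y_def inner_simps)
    ultimately have "sgn y \<bullet> 1 = 0 \<and> norm (sgn y) = 1" by (simp add: sgn_div_norm)
    then show False using False by blast
  qed
  have f_rep: "f (a *\<^sub>R 1) = a" for a using 1 by (simp add: f_def)
  have lin: "linear f" by (rule linearI) (simp_all add: f_def inner_simps)
  have bij: "bij f"
  proof (rule bijI)
    show "inj f" by (rule injI) (metis rep f_def)
    show "surj f" by (rule surjI[where f = "\<lambda>a. a *\<^sub>R 1"]) (simp add: f_rep)
  qed
  have mult: "f (x * y) = f x * f y" for x y
    by (subst rep[of x], subst rep[of y]) (simp add: f_def 1)
  have norm: "norm (f x) = norm x" for x
    by (subst (2) rep) (simp add: f_def)
  have cnj: "conjugate x = x" for x :: 'a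
  proof -
    have "of_real (real_part x) = x" using rep[of x] by (simp add: real_part_def of_real_def)
    then show ?thesis by (simp add: conjugate_def)
  qed
  have "dim (range f) = dim (UNIV :: 'a set)"
    by (rule dim_image_eq[OF lin]) (use bij in \<open>auto simp: bij_def inj_on_def\<close>)
  then have "DIM('a) = 1" using bij by (simp add: bij_def)
  then have beta: "beta_param TYPE('a) = 1 / 2" by (simp add: beta_param_def)
  show ?thesis
    by (intro disjI1 exI[of _ f]) (use bij lin mult norm cnj beta 1 in
        \<open>auto simp: f_def real_part_def\<close>)
qed

section \<open>Matrices and projections\<close>

definition ctranspose :: "'a::real_or_complex^'n^'m \<Rightarrow> 'a^'m^'n" where
  "ctranspose A = (\<chi> i j. conjugate (A $ j $ i))"

definition unitary :: "'a::real_or_complex^'d^'d \<Rightarrow> bool" where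
  "unitary U \<longleftrightarrow> ctranspose U ** U = mat 1 \<and> U ** ctranspose U = mat 1"

lemma unitary_real: "unitary U \<longleftrightarrow> orthogonal_matrix U" for U :: "real^'d^'d"
proof -
  have "ctranspose U = transpose U" by (simp add: ctranspose_def transpose_def)
  then show ?thesis by (simp add: unitary_def orthogonal_matrix_def)
qed

text \<open>The norm on the type of matrices is the Frobenius norm, hence the explicit operator norm.\<close>

definition opnorm :: "'a::real_or_complex^'d^'d \<Rightarrow> real" where
  "opnorm A = onorm (\<lambda>v. A *v v)"

text \<open>\<open>(Y *v v) \<bullet> v\<close> is the real part of the Hermitian form of \<open>Y\<close> at \<open>v\<close>.\<close>

definition psd :: "'a::real_or_complex^'d^'d \<Rightarrow> bool" where
  "psd Y \<longleftrightarrow> ctranspose Y = Y \<and> (\<forall>v. 0 \<le> (Y *v v) \<bullet> v)"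

definition Proj :: "nat \<Rightarrow> ('a::real_or_complex^'d^'d) set" where
  "Proj k = {P. ctranspose P = P \<and> P ** P = P \<and> rank P = k}"

definition proj_space :: "nat \<Rightarrow> ('a::real_or_complex^'d^'d) measure" where
  "proj_space k = restrict_space borel (Proj k)"

definition uniform_proj_measure :: "nat \<Rightarrow> ('a::real_or_complex^'d^'d) measure \<Rightarrow> bool" where
  "uniform_proj_measure k N \<longleftrightarrow> prob_space N \<and> sets N = sets (proj_space k) \<and>
     (\<forall>U. unitary U \<longrightarrow> distr N (proj_space k) (\<lambda>P. U ** P ** ctranspose U) = N)"

section \<open>The constants\<close>

definition mu1 :: "real \<Rightarrow> nat \<Rightarrow> real" where
  "mu1 \<beta> n = 1 / 2 + 1 / (\<beta> * n * 4 powr (\<beta> * n) * Beta (\<beta> * n) (\<beta> * n))"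

definition mu2 :: "real \<Rightarrow> nat \<Rightarrow> real" where
  "mu2 \<beta> n = 1 / 2 - 1 / (\<beta> * n * (2 * real n - 1) * 4 powr (\<beta> * n) * Beta (\<beta> * n) (\<beta> * n))"

section \<open>Binary measurements and the principal eigenspace program\<close>

text \<open>The trace of a product of two Hermitian matrices is real.\<close>

definition phi :: "'a::real_or_complex^'d^'d \<Rightarrow> 'a^'d^'d \<Rightarrow> nat" where
  "phi P X = (if real_part (trace (P ** X)) \<ge> 1 / 2 then 1 else 0)"

definition Phi :: "(nat \<Rightarrow> 'a::real_or_complex^'d^'d) \<Rightarrow> 'a^'d^'d \<Rightarrow> nat \<Rightarrow> nat" where
  "Phi P X = (\<lambda>j. phi (P j) X)"

definition pep_matrix :: "nat \<Rightarrow> (nat \<Rightarrow> 'a::real_or_complex^'d^'d) \<Rightarrow> (nat \<Rightarrow> nat) \<Rightarrow> 'a^'d^'d" where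
  "pep_matrix m P b = (1 / real m) *\<^sub>R (\<Sum>j=1..m. if b j = 1 then P j else mat 1 - P j)"

definition pep_feasible :: "'a::real_or_complex^'d^'d \<Rightarrow> bool" where
  "pep_feasible Y \<longleftrightarrow> psd Y \<and> real_part (trace Y) \<le> 1"

definition pep_optimal :: "'a::real_or_complex^'d^'d \<Rightarrow> 'a^'d^'d \<Rightarrow> bool" where
  "pep_optimal Q Y \<longleftrightarrow> pep_feasible Y \<and>
     (\<forall>Z. pep_feasible Z \<longrightarrow> real_part (trace (Q ** Z)) \<le> real_part (trace (Q ** Y)))"

text \<open>Real eigenvalues suffice, as these notions are applied to Hermitian matrices only.\<close>

definition eigenspace :: "'a::real_or_complex^'d^'d \<Rightarrow> real \<Rightarrow> ('a^'d) set" where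
  "eigenspace Q l = {v. Q *v v = l *\<^sub>R v}"

definition largest_eigenvalue :: "'a::real_or_complex^'d^'d \<Rightarrow> real \<Rightarrow> bool" where
  "largest_eigenvalue Q l \<longleftrightarrow> eigenspace Q l \<noteq> {0} \<and> (\<forall>l'. eigenspace Q l' \<noteq> {0} \<longrightarrow> l' \<le> l)"

text \<open>
  If the largest eigenvalue is not simple, there are several solutions, so this is a predicate.
\<close>

definition pep_solution ::
  "nat \<Rightarrow> (nat \<Rightarrow> 'a::real_or_complex^'d^'d) \<Rightarrow> (nat \<Rightarrow> nat) \<Rightarrow> 'a^'d^'d \<Rightarrow> bool" where
  "pep_solution m P b Y \<longleftrightarrow> pep_optimal (pep_matrix m P b) Y \<and> Y \<in> Proj 1 \<and>
     (\<exists>l. largest_eigenvalue (pep_matrix m P b) l \<and>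
          range (\<lambda>v. Y *v v) \<subseteq> eigenspace (pep_matrix m P b) l)"

end

theory Submission
  imports Defs
begin

text \<open>
  Write \<open>X = x x*\<close> with a unit vector \<open>x\<close>. The answer for \<open>P\<^sub>j\<close> selects \<open>R\<^sub>j\<close>, one of \<open>P\<^sub>j\<close> and
  \<open>1 - P\<^sub>j\<close>; put \<open>T\<^sub>j = 2 R\<^sub>j - 1\<close>, a reflection. A solution of the program is a rank one projection \<open>Y\<close>
  for which \<open>\<Sum>\<^sub>j T\<^sub>j\<close> has at least the trace against \<open>Y\<close> that it has against \<open>X\<close>. Three facts give the
  theorem.

  The mean of \<open>T\<^sub>j\<close> points at \<open>X\<close>: it is \<open>g 1 + d X\<close> with \<open>d \<ge> 2 (\<mu>\<^sub>1 - \<mu>\<^sub>2)\<close> (\<open>mean_observed\<close>). It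
  commutes with every unitary reflection that preserves the line of \<open>x\<close>, which forces this shape.
  Its value at \<open>x\<close> is the mean of \<open>\<bar>q\<bar>\<close>, where \<open>q = 2 \<langle>P x, x\<rangle> - 1\<close>. In place of the density of \<open>q\<close>,
  the proof uses only invariance. The mean of \<open>f(\<langle>P x, x\<rangle>) \<langle>P x, y\<rangle>\<close> vanishes for orthonormal \<open>x, y\<close>
  because the reflection in \<open>y\<close> changes its sign; differentiating this along the rotation of \<open>x\<close>
  towards \<open>y\<close> and summing over \<open>y\<close> gives a two-step recursion for the absolute moments of \<open>q\<close>
  (\<open>moment_recursion\<close>). Even moments are then known, and since moments decrease, the first moment is
  bounded below by a limit of Pochhammer quotients, which is the Beta function expression in
  \<open>\<mu>\<^sub>1\<close> (\<open>first_moment_lower_bound\<close>).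

  The sum \<open>Z\<close> of the centred \<open>T\<^sub>j\<close> concentrates (\<open>matrix_concentration\<close>): the probability that
  \<open>\<parallel>Z\<parallel> \<ge> s\<close> is at most \<open>4 n exp (- s\<^sup>2 / (4 m))\<close>. This rests on the moment bound
  \<open>E tr Z\<^bsup>2p\<^esup> \<le> 2 m (2 p - 1) E tr Z\<^bsup>2p-2\<^esup>\<close>, proved by replacing one summand by an independent copy and
  applying a mean value inequality for the trace (\<open>trace_inequality\<close>). No matrix exponential occurs:
  the moments are summed into \<open>cosh\<close> of the norm.

  The extremal problem is stable (\<open>opnorm_less_if_better_than_outer\<close>): if \<open>\<sigma>\<close> is the sine of the
  angle between the lines of \<open>X\<close> and \<open>Y\<close>, optimality says \<open>m d \<sigma>\<^sup>2 \<le> tr Z (Y - X) \<le> 2 \<parallel>Z\<parallel> \<sigma>\<close>, while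
  \<open>\<parallel>Y - X\<parallel> \<le> \<sigma>\<close>. So \<open>\<parallel>Z\<parallel> < m (\<mu>\<^sub>1 - \<mu>\<^sub>2) \<delta>\<close> suffices, and the tail bound there is at most \<open>exp (- D)\<close>,
  because \<open>14/3 \<ge> 4\<close>.
\<close>

section \<open>Scalars\<close>

lemma
  fixes x y :: "'a::real_or_complex"
  shows conjugate_add: "conjugate (x + y) = conjugate x + conjugate y"
    and conjugate_mult: "conjugate (x * y) = conjugate x * conjugate y"
    and conjugate_conjugate [simp]: "conjugate (conjugate x) = x"
    and mult_conjugate: "x * conjugate x = of_real ((norm x)\<^sup>2)"
    and inner_eq_real_part: "x \<bullet> y = real_part (x * conjugate y)"
proof -
  have add: "conjugate (x + y) = conjugate x + conjugate y" for x y :: 'a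
    by (simp add: conjugate_def real_part_def inner_simps algebra_simps)
  have mult: "conjugate (x * y) = conjugate x * conjugate y" for x y :: 'a
    using real_or_complex_cases[where 'a='a]
  proof (elim disjE exE conjE)
    fix f :: "'a \<Rightarrow> complex"
    assume f: "bij f" "\<forall>x y. f (x * y) = f x * f y" "\<forall>x. f (conjugate x) = cnj (f x)"
    then have "f (conjugate (x * y)) = f (conjugate x * conjugate y)" by simp
    then show ?thesis using f(1) by (simp add: bij_def inj_eq)
  qed simp
  have one: "(1::'a) \<bullet> 1 = 1" by (simp add: dot_square_norm)
  have conj2: "conjugate (conjugate x) = x" for x :: 'a
    by (simp add: conjugate_def real_part_def of_real_def inner_simps one algebra_simps)
  have sq: "x * conjugate x = of_real ((norm x)\<^sup>2)" for x :: 'a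
    using real_or_complex_cases[where 'a='a]
  proof (elim disjE exE conjE)
    fix f :: "'a \<Rightarrow> real"
    assume f: "bij f" "linear f" "f 1 = 1" "\<forall>x y. f (x * y) = f x * f y"
      "\<forall>x. norm (f x) = norm x" "\<forall>x::'a. conjugate x = x"
    have "f (of_real ((norm x)\<^sup>2)) = (norm x)\<^sup>2"
      using f by (simp add: of_real_def linear_scale)
    moreover have "f (x * conjugate x) = (norm x)\<^sup>2"
      using f by (metis power2_abs power2_eq_square real_norm_def)
    ultimately show ?thesis using f(1) by (metis bij_def inj_eq)
  next
    fix f :: "'a \<Rightarrow> complex"
    assume f: "bij f" "linear f" "f 1 = 1" "\<forall>x y. f (x * y) = f x * f y"
      "\<forall>x. norm (f x) = norm x" "\<forall>x. f (conjugate x) = cnj (f x)"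
    have "f (of_real ((norm x)\<^sup>2)) = complex_of_real ((norm x)\<^sup>2)"
      using f by (simp add: of_real_def linear_scale)
    moreover have "f (x * conjugate x) = complex_of_real ((norm x)\<^sup>2)"
      using f by (metis complex_norm_square of_real_power)
    ultimately show ?thesis using f(1) by (metis bij_def inj_eq)
  qed
  have rp_sq: "real_part (of_real r :: 'a) = r" for r
    by (simp add: real_part_def of_real_def one)
  have rp_add: "real_part (x + y) = real_part x + real_part y" for x y :: 'a
    by (simp add: real_part_def inner_simps)
  have rp_conj: "real_part (conjugate x) = real_part x" for x :: 'a
    by (simp add: conjugate_def real_part_def inner_simps of_real_def one)
  have "norm (x + y) ^ 2 = real_part ((x + y) * conjugate (x + y))"
    by (simp only: sq rp_sq)
  also have "\<dots> = norm x ^ 2 + norm y ^ 2 + real_part (x * conjugate y) + real_part (y * conjugate x)"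
    by (simp only: add distrib_left distrib_right rp_add sq rp_sq)
  also have "real_part (y * conjugate x) = real_part (x * conjugate y)"
    by (metis mult conj2 mult.commute rp_conj)
  finally have "norm x ^ 2 + norm y ^ 2 + 2 * (x \<bullet> y) = norm x ^ 2 + norm y ^ 2 + 2 * real_part (x * conjugate y)"
    by (simp add: power2_norm_eq_inner inner_simps inner_commute)
  then show "x \<bullet> y = real_part (x * conjugate y)" by simp
  show "conjugate (x + y) = conjugate x + conjugate y" by (rule add)
  show "conjugate (x * y) = conjugate x * conjugate y" by (rule mult)
  show "conjugate (conjugate x) = x" by (rule conj2)
  show "x * conjugate x = of_real ((norm x)\<^sup>2)" by (rule sq)
qed

lemma real_part_simps [simp]:
  fixes x y :: "'a::real_or_complex"
  shows real_part_of_real: "real_part (of_real r :: 'a) = r"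
    and real_part_add: "real_part (x + y) = real_part x + real_part y"
    and real_part_diff: "real_part (x - y) = real_part x - real_part y"
    and real_part_scaleR: "real_part (r *\<^sub>R x) = r * real_part x"
    and real_part_1: "real_part (1::'a) = 1"
    and real_part_0: "real_part (0::'a) = 0"
  by (simp_all add: real_part_def of_real_def inner_simps dot_square_norm)

lemma real_part_sum: "real_part (sum f A) = (\<Sum>i\<in>A. real_part (f i))"
  by (simp add: real_part_def inner_sum_left)

lemma conjugate_simps [simp]:
  fixes x y :: "'a::real_or_complex"
  shows conjugate_diff: "conjugate (x - y) = conjugate x - conjugate y"
    and conjugate_scaleR: "conjugate (r *\<^sub>R x) = r *\<^sub>R conjugate x"
    and conjugate_of_real: "conjugate (of_real r :: 'a) = of_real r"
    and conjugate_0: "conjugate (0::'a) = 0"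
    and conjugate_1: "conjugate (1::'a) = 1"
    and conjugate_minus: "conjugate (- x) = - conjugate x"
    and real_part_conjugate: "real_part (conjugate x) = real_part x"
proof -
  have "conjugate (of_real r :: 'a) = of_real r" for r
    by (simp only: conjugate_def real_part_of_real) simp
  from this this[of 0] this[of 1] show "conjugate (of_real r :: 'a) = of_real r"
    "conjugate (0::'a) = 0" "conjugate (1::'a) = 1" by simp_all
qed (simp_all add: conjugate_def real_part_def inner_simps scaleR_diff_right
      of_real_def dot_square_norm algebra_simps)

lemma conjugate_sum: "conjugate (sum f A) = (\<Sum>i\<in>A. conjugate (f i))"
  by (induction A rule: infinite_finite_induct) (auto simp: conjugate_add)

lemma inner_conjugate: "conjugate x \<bullet> conjugate y = x \<bullet> (y::'a::real_or_complex)"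
proof -
  have "real_part (conjugate x * y) = real_part (conjugate (conjugate x * y))"
    by (simp only: real_part_conjugate)
  then show ?thesis by (simp add: inner_eq_real_part conjugate_mult)
qed

lemma inner_mult_left_adjoint: "(a * b) \<bullet> c = b \<bullet> (conjugate a * (c::'a::real_or_complex))"
  by (simp add: inner_eq_real_part conjugate_mult mult_ac)

lemma inner_mult_both: "(a * b) \<bullet> (a * c) = (norm a)\<^sup>2 * (b \<bullet> (c::'a::real_or_complex))"
proof -
  have "conjugate a * (a * c) = (norm a)\<^sup>2 *\<^sub>R c"
    by (metis mult.assoc mult.commute mult_conjugate scaleR_conv_of_real)
  then show ?thesis by (simp add: inner_mult_left_adjoint)
qed

section \<open>Matrices\<close>

lemma ctranspose_nth [simp]: "ctranspose A $ i $ j = conjugate (A $ j $ i)"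
  by (simp add: ctranspose_def)

lemma ctranspose_simps [simp]:
  fixes A B :: "'a::real_or_complex^'n^'m"
  shows ctranspose_ctranspose: "ctranspose (ctranspose A) = A"
    and ctranspose_add: "ctranspose (A + B) = ctranspose A + ctranspose B"
    and ctranspose_diff: "ctranspose (A - B) = ctranspose A - ctranspose B"
    and ctranspose_scaleR: "ctranspose (r *\<^sub>R A) = r *\<^sub>R ctranspose A"
    and ctranspose_0: "ctranspose (0 :: 'a^'n^'m) = 0"
  by (simp_all add: vec_eq_iff conjugate_add)

lemma ctranspose_mat1 [simp]: "ctranspose (mat 1 :: 'a::real_or_complex^'n^'n) = mat 1"
  by (simp add: vec_eq_iff mat_def)

lemma ctranspose_sum: "ctranspose (sum f A) = (\<Sum>i\<in>A. ctranspose (f i))"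
  by (induction A rule: infinite_finite_induct) auto

lemma ctranspose_mult: "ctranspose (A ** B) = ctranspose B ** ctranspose A"
  by (simp add: vec_eq_iff matrix_matrix_mult_def conjugate_sum conjugate_mult mult.commute)

lemma matrix_mult_linear:
  fixes A B :: "'a::real_or_complex^'n^'m" and C D :: "'a^'p^'n"
  shows matrix_mult_add_left: "(A + B) ** C = A ** C + B ** C"
    and matrix_mult_diff_left: "(A - B) ** C = A ** C - B ** C"
    and matrix_mult_add_right: "A ** (C + D) = A ** C + A ** D"
    and matrix_mult_diff_right: "A ** (C - D) = A ** C - A ** D"
    and matrix_mult_scaleR_left: "(r *\<^sub>R A) ** C = r *\<^sub>R (A ** C)"
    and matrix_mult_scaleR_right: "A ** (r *\<^sub>R C) = r *\<^sub>R (A ** C)"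
  by (simp_all add: vec_eq_iff matrix_matrix_mult_def algebra_simps sum.distrib sum_subtractf
      scaleR_sum_right)

lemma matrix_vector_linear:
  fixes A B :: "'a::real_or_complex^'n^'m" and v w :: "'a^'n"
  shows mv_add_left: "(A + B) *v v = A *v v + B *v v"
    and mv_diff_left: "(A - B) *v v = A *v v - B *v v"
    and mv_add_right: "A *v (v + w) = A *v v + A *v w"
    and mv_diff_right: "A *v (v - w) = A *v v - A *v w"
    and mv_scaleR_left: "(r *\<^sub>R A) *v v = r *\<^sub>R (A *v v)"
    and mv_scaleR_right: "A *v (r *\<^sub>R v) = r *\<^sub>R (A *v v)"
    and mv_scale_right: "A *v (c *s v) = c *s (A *v v)"
  by (simp_all add: vec_eq_iff matrix_vector_mult_def algebra_simps sum.distrib sum_subtractf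
      scaleR_sum_right sum_distrib_left)

lemma linear_mv: "linear (\<lambda>v. A *v v)" for A :: "'a::real_or_complex^'n^'m"
  by (rule linearI) (simp_all add: mv_add_right mv_scaleR_right)

lemma inner_mv_left: "(A *v v) \<bullet> w = v \<bullet> (ctranspose A *v w)"
  for A :: "'a::real_or_complex^'n^'m"
proof -
  have "(A *v v) \<bullet> w = (\<Sum>i\<in>UNIV. \<Sum>j\<in>UNIV. v $ j \<bullet> (conjugate (A $ i $ j) * w $ i))"
    by (simp add: inner_vec_def matrix_vector_mult_def inner_sum_left inner_mult_left_adjoint)
  also have "\<dots> = (\<Sum>j\<in>UNIV. \<Sum>i\<in>UNIV. v $ j \<bullet> (conjugate (A $ i $ j) * w $ i))"
    by (rule sum.swap)
  also have "\<dots> = v \<bullet> (ctranspose A *v w)"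
    by (simp add: inner_vec_def matrix_vector_mult_def inner_sum_right)
  finally show ?thesis .
qed

lemma inner_ctranspose: "ctranspose A \<bullet> ctranspose B = A \<bullet> B"
  for A :: "'a::real_or_complex^'n^'m"
  by (simp add: inner_vec_def inner_conjugate) (rule sum.swap)

lemma inner_matrix_columns: "A \<bullet> B = (\<Sum>j\<in>UNIV. column j A \<bullet> column j B)"
  for A :: "'a::real_or_complex^'n^'m"
  by (simp add: inner_vec_def column_def) (rule sum.swap)

lemma column_matrix_mult: "column j (A ** B) = A *v column j B"
  by (simp add: vec_eq_iff column_def matrix_matrix_mult_def matrix_vector_mult_def)

text \<open>
  The inner product of matrices is the real part of \<open>tr (A B*)\<close>. This and the next lemma are its
  cyclic invariance; all trace computations below are done with them.
\<close>

lemma inner_matrix_mult_left: "(A ** B) \<bullet> C = B \<bullet> (ctranspose A ** C)"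
  for A :: "'a::real_or_complex^'n^'m"
  by (simp add: inner_matrix_columns column_matrix_mult inner_mv_left)

lemma inner_matrix_mult_right: "(A ** B) \<bullet> C = A \<bullet> (C ** ctranspose B)"
  for A :: "'a::real_or_complex^'n^'m"
proof -
  have "(A ** B) \<bullet> C = ctranspose (A ** B) \<bullet> ctranspose C" by (simp only: inner_ctranspose)
  also have "\<dots> = ctranspose A \<bullet> ctranspose (C ** ctranspose B)"
    by (simp add: ctranspose_mult inner_matrix_mult_left)
  finally show ?thesis by (simp only: inner_ctranspose)
qed

lemma norm_matrix_mult_le:
  fixes A :: "'a::real_or_complex^'n^'m" and B :: "'a^'p^'n"
  assumes "\<And>v. norm (A *v v) \<le> c * norm v" "c \<ge> 0"
  shows "norm (A ** B) \<le> c * norm B"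
proof -
  have "(norm (A ** B))\<^sup>2 = (\<Sum>j\<in>UNIV. (norm (A *v column j B))\<^sup>2)"
    by (simp add: power2_norm_eq_inner inner_matrix_columns column_matrix_mult)
  also have "\<dots> \<le> (\<Sum>j\<in>UNIV. (c * norm (column j B))\<^sup>2)"
    by (intro sum_mono power_mono assms) auto
  also have "\<dots> = c\<^sup>2 * (norm B)\<^sup>2"
    by (simp add: power_mult_distrib power2_norm_eq_inner inner_matrix_columns[of B] sum_distrib_left)
  finally show ?thesis
    using assms(2) by (simp add: power_mult_distrib[symmetric] power2_le_iff_abs_le abs_mult)
qed

lemma norm_mv_le: "norm (A *v v) \<le> norm A * norm v" for A :: "'a::real_or_complex^'n^'m"
proof -
  have "(norm (A *v v))\<^sup>2 = (\<Sum>i\<in>UNIV. (norm (\<Sum>j\<in>UNIV. A $ i $ j * v $ j))\<^sup>2)"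
    by (simp add: power2_norm_eq_inner inner_vec_def matrix_vector_mult_def)
  also have "\<dots> \<le> (\<Sum>i\<in>UNIV. (\<Sum>j\<in>UNIV. norm (A $ i $ j) * norm (v $ j))\<^sup>2)"
    by (intro sum_mono power_mono) (auto intro!: sum_norm_le simp: norm_mult)
  also have "\<dots> \<le> (\<Sum>i\<in>UNIV. (\<Sum>j\<in>UNIV. (norm (A $ i $ j))\<^sup>2) * (\<Sum>j\<in>UNIV. (norm (v $ j))\<^sup>2))"
    by (intro sum_mono Cauchy_Schwarz_ineq_sum)
  also have "\<dots> = (norm A)\<^sup>2 * (norm v)\<^sup>2"
    by (simp add: sum_distrib_right[symmetric] power2_norm_eq_inner inner_vec_def)
  finally show ?thesis
    by (simp add: power_mult_distrib[symmetric] power2_le_iff_abs_le abs_mult)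
qed

lemma norm_matrix_mult: "norm (A ** B) \<le> norm A * norm B"
  for A :: "'a::real_or_complex^'n^'m" and B :: "'a^'p^'n"
  by (rule norm_matrix_mult_le) (auto simp: norm_mv_le)

lemma real_part_trace_mult: "real_part (trace (A ** B)) = A \<bullet> ctranspose B"
  for A :: "'a::real_or_complex^'n^'n"
  by (simp add: trace_def matrix_matrix_mult_def inner_vec_def inner_eq_real_part real_part_sum)

lemma norm_mat1_squared: "(norm (mat 1 :: 'a::real_or_complex^'n^'n))\<^sup>2 = CARD('n)"
proof -
  have "(mat 1 :: 'a^'n^'n) $ i $ j \<bullet> mat 1 $ i $ j = of_bool (i = j)" for i j :: 'n
    by (simp add: mat_def dot_square_norm)
  then show ?thesis by (simp add: power2_norm_eq_inner inner_vec_def)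
qed

section \<open>A trace inequality for matrix powers\<close>

text \<open>
  The library power on the type of matrices multiplies componentwise, hence this one.
\<close>

primrec mpow :: "'a::real_or_complex^'d^'d \<Rightarrow> nat \<Rightarrow> 'a^'d^'d" where
  "mpow A 0 = mat 1"
| "mpow A (Suc k) = A ** mpow A k"

lemma mpow_add: "mpow A (i + j) = mpow A i ** mpow A j"
  by (induction i) (simp_all add: matrix_mul_assoc)

lemma mpow_Suc_right: "mpow A (Suc k) = mpow A k ** A"
  using mpow_add[of A k 1] by simp

lemma ctranspose_mpow: "ctranspose A = A \<Longrightarrow> ctranspose (mpow A k) = mpow A k"
  by (induction k) (simp_all add: ctranspose_mult mpow_Suc_right[symmetric])

lemma norm_mpow_le: "norm (mpow A k) \<le> norm A ^ k * norm (mat 1 :: 'a^'d^'d)"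
  for A :: "'a::real_or_complex^'d^'d"
proof (induction k)
  case (Suc k)
  have "norm (mpow A (Suc k)) \<le> norm A * norm (mpow A k)" by (simp add: norm_matrix_mult)
  also have "\<dots> \<le> norm A * (norm A ^ k * norm (mat 1 :: 'a^'d^'d))"
    by (intro mult_left_mono Suc) auto
  finally show ?case by (simp add: mult_ac)
qed simp

lemma norm_mpow_squared:
  assumes "ctranspose A = A"
  shows "(norm (mpow A (Suc q)))\<^sup>2 = A \<bullet> mpow A (2 * q + 1)"
proof -
  have "(norm (mpow A (Suc q)))\<^sup>2 = (A ** mpow A q) \<bullet> mpow A (Suc q)"
    by (simp only: power2_norm_eq_inner mpow.simps)
  also have "\<dots> = A \<bullet> mpow A (Suc q + q)"
    using assms by (simp only: inner_matrix_mult_right ctranspose_mpow mpow_add[of A "Suc q" q])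
  finally show ?thesis by (simp add: mult_2)
qed

lemma matrix_mult_sum_left: "sum f S ** C = (\<Sum>i\<in>S. f i ** C)"
  for C :: "'a::real_or_complex^'p^'n"
  by (induction S rule: infinite_finite_induct) (auto simp: matrix_mult_add_left)

lemma mpow_diff_telescope:
  "mpow A N - mpow B N = (\<Sum>k<N. mpow A k ** (A - B) ** mpow B (N - 1 - k))"
proof (induction N)
  case (Suc N)
  have "(\<Sum>k<Suc N. mpow A k ** (A - B) ** mpow B (Suc N - 1 - k)) =
      (\<Sum>k<N. mpow A k ** (A - B) ** mpow B (N - k)) + mpow A N ** (A - B)"
    by simp
  also have "(\<Sum>k<N. mpow A k ** (A - B) ** mpow B (N - k)) =
      (\<Sum>k<N. mpow A k ** (A - B) ** mpow B (N - 1 - k) ** B)"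
  proof (rule sum.cong)
    fix k assume "k \<in> {..<N}"
    then have "N - k = Suc (N - 1 - k)" by auto
    then show "mpow A k ** (A - B) ** mpow B (N - k) = mpow A k ** (A - B) ** mpow B (N - 1 - k) ** B"
      by (simp only: mpow_Suc_right matrix_mul_assoc)
  qed simp
  also have "\<dots> = (\<Sum>k<N. mpow A k ** (A - B) ** mpow B (N - 1 - k)) ** B"
    by (simp only: matrix_mult_sum_left)
  also have "\<dots> = (mpow A N - mpow B N) ** B" by (simp only: Suc)
  finally show ?case
    by (simp add: mpow_Suc_right matrix_mult_diff_left matrix_mult_diff_right del: mpow.simps)
qed simp

text \<open>
  The increments of a convex sequence increase, so the first \<open>i\<close> of them sum to at most the last \<open>i\<close>.
\<close>

lemma convex_sequence_ends:
  fixes u :: "nat \<Rightarrow> real"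
  assumes "\<And>i. 0 < i \<Longrightarrow> i < q \<Longrightarrow> 2 * u i \<le> u (i - 1) + u (i + 1)" "i \<le> q"
  shows "u i + u (q - i) \<le> u 0 + u q"
proof -
  define d where "d k = u (Suc k) - u k" for k
  have d: "d k \<le> d (k + j)" if "k + j < q" for k j
    using that
  proof (induction j)
    case (Suc j)
    then show ?case using assms(1)[of "Suc (k + j)"] by (simp add: d_def)
  qed simp
  have tele: "(\<Sum>k<j. d (l + k)) = u (l + j) - u l" for l j
    by (induction j) (simp_all add: d_def)
  have "(\<Sum>k<i. d (0 + k)) \<le> (\<Sum>k<i. d (q - i + k))"
    using assms(2) d[of _ "q - i"] by (intro sum_mono) (auto simp: add.commute)
  then show ?thesis using assms(2) unfolding tele by simp
qed

text \<open>
  A mean value inequality for \<open>z \<mapsto> z\<^bsup>2q+1\<^esup>\<close> under the trace. With \<open>C = A - B\<close>, telescoping writes the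
  left-hand side as the sum over \<open>k \<le> 2q\<close> of \<open>T k = tr (C A\<^bsup>k\<^esup> C B\<^bsup>2q-k\<^esup>)\<close>. By Cauchy-Schwarz the numbers
  \<open>T (2 i)\<close> form a convex sequence and the odd terms are at most the mean of their neighbours, so
  \<open>T k + T (2q - k)\<close> is at most the sum of the two end terms, which are the norms on the right.
\<close>

lemma trace_inequality:
  assumes A: "ctranspose A = A" and B: "ctranspose B = B"
  shows "(A - B) \<bullet> (mpow A (2 * q + 1) - mpow B (2 * q + 1)) \<le>
    (2 * real q + 1) / 2 * ((norm ((A - B) ** mpow A q))\<^sup>2 + (norm ((A - B) ** mpow B q))\<^sup>2)"
proof -
  define C where "C = A - B"
  have C: "ctranspose C = C" using A B by (simp add: C_def)
  define T where "T k = C \<bullet> (mpow A k ** C ** mpow B (2 * q - k))" for k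
  define V where "V i = mpow A i ** C ** mpow B (q - i)" for i
  define u where "u i = (norm (V i))\<^sup>2" for i
  have T_eq: "T (i + j) = V i \<bullet> V j" if "i \<le> q" "j \<le> q" for i j
  proof -
    have "V i \<bullet> V j = (mpow A i ** C) \<bullet> (V j ** mpow B (q - i))"
      by (simp add: V_def[of i] inner_matrix_mult_right ctranspose_mpow[OF B])
    also have "\<dots> = C \<bullet> ((mpow A i ** mpow A j) ** C ** (mpow B (q - j) ** mpow B (q - i)))"
      by (simp add: V_def inner_matrix_mult_left ctranspose_mpow[OF A] matrix_mul_assoc)
    also have "\<dots> = T (i + j)"
      unfolding T_def mpow_add[symmetric] using that by (simp add: mult_2 add.commute)
    finally show ?thesis ..
  qed
  have T_le: "T (i + j) \<le> (u i + u j) / 2" if "i \<le> q" "j \<le> q" for i j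
  proof -
    have "0 \<le> (norm (V i - V j))\<^sup>2" by simp
    also have "\<dots> = u i + u j - 2 * (V i \<bullet> V j)"
      by (simp add: u_def power2_norm_eq_inner inner_simps inner_commute)
    finally show ?thesis using T_eq[OF that] by simp
  qed
  have u_T: "u i = T (i + i)" if "i \<le> q" for i
    using T_eq[OF that that] by (simp add: u_def power2_norm_eq_inner)
  have ends: "u i + u (q - i) \<le> u 0 + u q" if "i \<le> q" for i
  proof (rule convex_sequence_ends[OF _ that])
    fix i assume i: "0 < i" "i < q"
    then have "i + i = (i - 1) + (i + 1)" by simp
    then have "u i = T ((i - 1) + (i + 1))" using u_T[of i] i by simp
    also have "\<dots> \<le> (u (i - 1) + u (i + 1)) / 2" using i by (intro T_le) auto
    finally show "2 * u i \<le> u (i - 1) + u (i + 1)" by simp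
  qed
  have pair: "T k + T (2 * q - k) \<le> u 0 + u q" if "k \<le> 2 * q" for k
  proof -
    define i j where "i = k div 2" and "j = k - k div 2"
    have ij: "i \<le> q" "j \<le> q" "k = i + j" "2 * q - k = (q - i) + (q - j)"
      using that by (auto simp: i_def j_def)
    have "T k + T (2 * q - k) \<le> (u i + u j) / 2 + (u (q - i) + u (q - j)) / 2"
      unfolding ij(4) unfolding ij(3) by (intro add_mono T_le) (use ij in auto)
    also have "\<dots> \<le> u 0 + u q" using ends[OF ij(1)] ends[OF ij(2)] by argo
    finally show ?thesis .
  qed
  have "2 * (\<Sum>k<2 * q + 1. T k) = (\<Sum>k<2 * q + 1. T k) + (\<Sum>k<2 * q + 1. T (2 * q + 1 - Suc k))"
    by (simp only: sum.nat_diff_reindex mult_2)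
  also have "\<dots> = (\<Sum>k<2 * q + 1. T k + T (2 * q - k))" by (simp only: sum.distrib) simp
  also have "\<dots> \<le> (\<Sum>k<2 * q + 1. u 0 + u q)" by (intro sum_mono pair) simp
  finally have "(\<Sum>k<2 * q + 1. T k) \<le> (2 * real q + 1) / 2 * (u q + u 0)"
    by (simp add: algebra_simps)
  moreover have "(A - B) \<bullet> (mpow A (2 * q + 1) - mpow B (2 * q + 1)) = (\<Sum>k<2 * q + 1. T k)"
    by (simp only: mpow_diff_telescope inner_sum_right T_def C_def diff_add_inverse2)
  moreover have "u 0 = (norm (C ** mpow B q))\<^sup>2" by (simp add: u_def V_def)
  moreover have "u q = (norm (C ** mpow A q))\<^sup>2"
  proof -
    have "ctranspose (V q) = C ** mpow A q"
      by (simp add: V_def ctranspose_mult ctranspose_mpow A C)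
    then show ?thesis by (metis u_def power2_norm_eq_inner inner_ctranspose)
  qed
  ultimately show ?thesis by (simp add: C_def)
qed

text \<open>
  The norms of \<open>A\<^bsup>k\<^esup> v\<close> are log-convex in \<open>k\<close> by Cauchy-Schwarz, so they grow at least geometrically.
  This replaces the spectral theorem in passing from trace moments to the operator norm.
\<close>

lemma norm_mv_power_le:
  assumes A: "ctranspose A = A" and v: "norm v = 1"
  shows "norm (A *v v) ^ p \<le> norm (mpow A p)"
proof -
  define w where "w k = norm (mpow A k *v v)" for k
  have "w p \<ge> w 1 ^ p \<and> w 1 * w p \<le> w (Suc p)"
  proof (induction p)
    case 0
    show ?case using v by (simp add: w_def)
  next
    case (Suc p)
    have "(w (Suc p))\<^sup>2 = (A *v (mpow A p *v v)) \<bullet> (mpow A (Suc p) *v v)"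
      by (simp add: w_def power2_norm_eq_inner matrix_vector_mul_assoc)
    also have "\<dots> = (mpow A p *v v) \<bullet> (mpow A (Suc (Suc p)) *v v)"
      by (subst inner_mv_left) (simp add: A matrix_vector_mul_assoc)
    also have "\<dots> \<le> w p * w (Suc (Suc p))"
      unfolding w_def by (rule norm_cauchy_schwarz)
    finally have 1: "(w (Suc p))\<^sup>2 \<le> w p * w (Suc (Suc p))" .
    have "w 1 * w (Suc p) \<le> w (Suc (Suc p))"
    proof (cases "w p = 0")
      case True
      then have "w (Suc p) = 0" using 1 by simp
      then show ?thesis by (simp add: w_def)
    next
      case False
      then have pos: "w p > 0" by (simp add: w_def)
      have "w p * (w 1 * w (Suc p)) = (w 1 * w p) * w (Suc p)" by simp
      also have "\<dots> \<le> w (Suc p) * w (Suc p)"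
        using Suc by (intro mult_right_mono) (auto simp: w_def)
      also have "\<dots> \<le> w p * w (Suc (Suc p))" using 1 by (simp add: power2_eq_square)
      finally show ?thesis using pos by simp
    qed
    moreover have "w 1 ^ Suc p \<le> w 1 * w p"
      using Suc by (auto intro!: mult_left_mono simp: w_def)
    ultimately show ?case using Suc by linarith
  qed
  then have "w 1 ^ p \<le> w p" by simp
  also have "w p \<le> norm (mpow A p)" unfolding w_def using norm_mv_le[of "mpow A p" v] v by simp
  finally show ?thesis by (simp add: w_def)
qed

section \<open>Concentration of sums of independent Hermitian matrices\<close>

lemma continuous_on_matrix_mult [continuous_intros]:
  fixes f :: "'b::topological_space \<Rightarrow> 'a::real_or_complex^'n^'m" and g :: "'b \<Rightarrow> 'a^'p^'n"
  assumes "continuous_on S f" "continuous_on S g"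
  shows "continuous_on S (\<lambda>x. f x ** g x)"
  unfolding matrix_matrix_mult_def using assms by (intro continuous_intros)

lemma continuous_on_mpow [continuous_intros]:
  "continuous_on S f \<Longrightarrow> continuous_on S (\<lambda>x. mpow (f x) k)"
  by (induction k) (auto intro!: continuous_intros)

lemma borel_measurable_mpow [measurable (raw)]:
  "f \<in> borel_measurable M \<Longrightarrow> (\<lambda>x. mpow (f x) k) \<in> borel_measurable M"
  by (rule borel_measurable_continuous_on[where f = "\<lambda>A. mpow A k"]) (auto intro!: continuous_intros)

text \<open>
  Fubini for a function of two independent variables, with both integrals over the original space.
\<close>

lemma (in prob_space) integral_indep_var_iterated:
  fixes F :: "'b::second_countable_topology \<times> 'b \<Rightarrow> real"
  assumes ind: "indep_var borel A borel Y"
    and F: "F \<in> borel_measurable borel"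
    and int: "integrable M (\<lambda>\<omega>. F (A \<omega>, Y \<omega>))"
  shows "(\<integral>\<omega>. F (A \<omega>, Y \<omega>) \<partial>M) = (\<integral>\<omega>'. (\<integral>\<omega>. F (A \<omega>', Y \<omega>) \<partial>M) \<partial>M)"
    and "integrable M (\<lambda>\<omega>'. (\<integral>\<omega>. F (A \<omega>', Y \<omega>) \<partial>M))"
proof -
  have [measurable]: "A \<in> borel_measurable M" "Y \<in> borel_measurable M"
    using ind indep_var_rv1 indep_var_rv2 by blast+
  interpret A: prob_space "distr M borel A" by (rule prob_space_distr) simp
  interpret Y: prob_space "distr M borel Y" by (rule prob_space_distr) simp
  interpret P: pair_prob_space "distr M borel A" "distr M borel Y" ..
  have [measurable]: "F \<in> borel_measurable (borel \<Otimes>\<^sub>M borel)"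
    using F by (simp add: borel_prod)
  have joint: "distr M borel A \<Otimes>\<^sub>M distr M borel Y = distr M (borel \<Otimes>\<^sub>M borel) (\<lambda>x. (A x, Y x))"
    using ind by (simp add: indep_var_distribution_eq)
  have intF: "integrable (distr M borel A \<Otimes>\<^sub>M distr M borel Y) F"
    unfolding joint using int by (simp add: integrable_distr_eq)
  have inner: "(\<integral>y. F (a, y) \<partial>distr M borel Y) = (\<integral>\<omega>. F (a, Y \<omega>) \<partial>M)" for a
    by (rule integral_distr) auto
  have [measurable]: "(\<lambda>a. \<integral>\<omega>. F (a, Y \<omega>) \<partial>M) \<in> borel_measurable borel"
    by measurable
  have "(\<integral>\<omega>. F (A \<omega>, Y \<omega>) \<partial>M) = integral\<^sup>L (distr M borel A \<Otimes>\<^sub>M distr M borel Y) F"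
    unfolding joint by (subst integral_distr) auto
  also have "\<dots> = (\<integral>a. (\<integral>\<omega>. F (a, Y \<omega>) \<partial>M) \<partial>distr M borel A)"
    by (simp add: P.integral_fst'[OF intF, symmetric] inner)
  also have "\<dots> = (\<integral>\<omega>'. (\<integral>\<omega>. F (A \<omega>', Y \<omega>) \<partial>M) \<partial>M)"
    by (rule integral_distr) auto
  finally show "(\<integral>\<omega>. F (A \<omega>, Y \<omega>) \<partial>M) = (\<integral>\<omega>'. (\<integral>\<omega>. F (A \<omega>', Y \<omega>) \<partial>M) \<partial>M)" .
  have "integrable (distr M borel A) (\<lambda>a. \<integral>\<omega>. F (a, Y \<omega>) \<partial>M)"
    using P.integrable_fst'[OF intF] by (simp add: inner)
  then show "integrable M (\<lambda>\<omega>'. (\<integral>\<omega>. F (A \<omega>', Y \<omega>) \<partial>M))"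
    by (simp add: integrable_distr_eq)
qed

lemma (in prob_space) integrable_bounded:
  fixes f :: "'a \<Rightarrow> 'b::{banach, second_countable_topology}"
  assumes "f \<in> borel_measurable M" "\<And>\<omega>. \<omega> \<in> space M \<Longrightarrow> norm (f \<omega>) \<le> K"
  shows "integrable M f"
  using assms by (intro integrable_const_bound[where B = K]) auto

lemma norm_mpow_bound:
  fixes A :: "'a::real_or_complex^'d^'d"
  assumes "norm A \<le> K"
  shows "norm (mpow A q) \<le> K ^ q * norm (mat 1 :: 'a^'d^'d)"
  using norm_mpow_le[of A q] power_mono[OF assms norm_ge_zero, of q]
  by (meson mult_right_mono norm_ge_zero order_trans)

context prob_space
begin

text \<open>
  Let \<open>Y'\<close> be an independent copy of \<open>Y\<close>, and \<open>h(Y) = (A + Y)\<^bsup>2q+1\<^esup>\<close>. As \<open>Y\<close> is centred, twice the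
  left-hand side is the mean of \<open>tr (Y - Y') (h(Y) - h(Y'))\<close>, to which the trace inequality applies;
  the factors \<open>Y - Y'\<close> it produces have operator norm at most 2. The copy is realized by a second
  integration over the same space.
\<close>

lemma one_summand_moment:
  fixes A :: "'c::real_or_complex^'d^'d" and Y :: "'a \<Rightarrow> 'c^'d^'d"
  assumes A: "ctranspose A = A"
    and Y [measurable]: "Y \<in> borel_measurable M"
    and herm: "\<And>\<omega>. \<omega> \<in> space M \<Longrightarrow> ctranspose (Y \<omega>) = Y \<omega>"
    and bound: "\<And>\<omega>. \<omega> \<in> space M \<Longrightarrow> norm (Y \<omega>) \<le> K"
    and diff: "\<And>\<omega> \<omega>' v. \<omega> \<in> space M \<Longrightarrow> \<omega>' \<in> space M \<Longrightarrow> norm ((Y \<omega> - Y \<omega>') *v v) \<le> 2 * norm v"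
    and mean: "(\<integral>\<omega>. Y \<omega> \<partial>M) = 0"
  shows "(\<integral>\<omega>. Y \<omega> \<bullet> mpow (A + Y \<omega>) (2 * q + 1) \<partial>M) \<le>
    2 * (2 * real q + 1) * (\<integral>\<omega>. (norm (mpow (A + Y \<omega>) q))\<^sup>2 \<partial>M)"
proof -
  define h where "h \<omega> = mpow (A + Y \<omega>) (2 * q + 1)" for \<omega>
  define g where "g \<omega> = (norm (mpow (A + Y \<omega>) q))\<^sup>2" for \<omega>
  have [measurable]: "h \<in> borel_measurable M" "g \<in> borel_measurable M"
    unfolding h_def g_def by measurable
  define L where "L = (norm A + K) ^ (2 * q + 1) * norm (mat 1 :: 'c^'d^'d)"
  have AY: "norm (A + Y \<omega>) \<le> norm A + K" if "\<omega> \<in> space M" for \<omega>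
    using norm_triangle_ineq[of A "Y \<omega>"] bound[OF that] by simp
  have h_bound: "norm (h \<omega>) \<le> L" if "\<omega> \<in> space M" for \<omega>
    unfolding h_def L_def by (rule norm_mpow_bound[OF AY[OF that]])
  have g_bound: "norm (g \<omega>) \<le> ((norm A + K) ^ q * norm (mat 1 :: 'c^'d^'d))\<^sup>2" if "\<omega> \<in> space M" for \<omega>
    unfolding g_def using norm_mpow_bound[OF AY[OF that]] by (simp add: power_mono)
  have K0: "0 \<le> K" using bound not_empty by (meson norm_ge_zero order_trans ex_in_conv)
  have int_Y: "integrable M Y" by (rule integrable_bounded[OF _ bound]) auto
  have int_h: "integrable M h" by (rule integrable_bounded[OF _ h_bound]) auto
  have int_g: "integrable M g" by (rule integrable_bounded[OF _ g_bound]) auto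
  have int_Yh: "integrable M (\<lambda>\<omega>. Y \<omega> \<bullet> h \<omega>)"
  proof (rule integrable_bounded[where K = "K * L"])
    fix \<omega> assume w: "\<omega> \<in> space M"
    have "norm (Y \<omega> \<bullet> h \<omega>) \<le> norm (Y \<omega>) * norm (h \<omega>)" by (simp add: Cauchy_Schwarz_ineq2)
    also have "\<dots> \<le> K * L" using bound[OF w] h_bound[OF w] K0 by (intro mult_mono) auto
    finally show "norm (Y \<omega> \<bullet> h \<omega>) \<le> K * L" .
  qed measurable
  define I where "I = (\<integral>\<omega>. Y \<omega> \<bullet> h \<omega> \<partial>M)"
  define H where "H = (\<integral>\<omega>. h \<omega> \<partial>M)"
  define G where "G = (\<integral>\<omega>. g \<omega> \<partial>M)"
  define c where "c = 2 * (2 * real q + 1)"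
  have pointwise: "(Y \<omega> - Y \<omega>') \<bullet> (h \<omega> - h \<omega>') \<le> c * (g \<omega> + g \<omega>')"
    if w: "\<omega> \<in> space M" "\<omega>' \<in> space M" for \<omega> \<omega>'
  proof -
    have d: "(A + Y \<omega>) - (A + Y \<omega>') = Y \<omega> - Y \<omega>'" by simp
    have n: "(norm ((Y \<omega> - Y \<omega>') ** B))\<^sup>2 \<le> 4 * (norm B)\<^sup>2" for B :: "'c^'d^'d"
      using power_mono[OF norm_matrix_mult_le[OF diff[OF w], of B] norm_ge_zero, of 2]
      by (simp add: power_mult_distrib)
    have "(Y \<omega> - Y \<omega>') \<bullet> (h \<omega> - h \<omega>') \<le> (2 * real q + 1) / 2 *
        ((norm ((Y \<omega> - Y \<omega>') ** mpow (A + Y \<omega>) q))\<^sup>2 + (norm ((Y \<omega> - Y \<omega>') ** mpow (A + Y \<omega>') q))\<^sup>2)"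
      using trace_inequality[of "A + Y \<omega>" "A + Y \<omega>'" q] A herm w unfolding d h_def by simp
    also have "\<dots> \<le> (2 * real q + 1) / 2 * (4 * g \<omega> + 4 * g \<omega>')"
      unfolding g_def by (intro mult_left_mono add_mono n) auto
    also have "\<dots> = c * (g \<omega> + g \<omega>')" by (simp add: c_def field_simps)
    finally show ?thesis .
  qed
  have inner: "Y \<omega> \<bullet> h \<omega> - Y \<omega> \<bullet> H + I \<le> c * (g \<omega> + G)" if w: "\<omega> \<in> space M" for \<omega>
  proof -
    have e: "(Y \<omega> - Y \<omega>') \<bullet> (h \<omega> - h \<omega>') =
        Y \<omega> \<bullet> h \<omega> - Y \<omega> \<bullet> h \<omega>' - Y \<omega>' \<bullet> h \<omega> + Y \<omega>' \<bullet> h \<omega>'" for \<omega>'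
      by (simp add: inner_simps)
    have "(\<integral>\<omega>'. (Y \<omega> - Y \<omega>') \<bullet> (h \<omega> - h \<omega>') \<partial>M) = Y \<omega> \<bullet> h \<omega> - Y \<omega> \<bullet> H - 0 \<bullet> h \<omega> + I"
      unfolding e H_def I_def mean[symmetric]
      using int_Y int_h int_Yh by (simp add: prob_space)
    moreover have "(\<integral>\<omega>'. (Y \<omega> - Y \<omega>') \<bullet> (h \<omega> - h \<omega>') \<partial>M) \<le> (\<integral>\<omega>'. c * (g \<omega> + g \<omega>') \<partial>M)"
      using pointwise[OF w] int_Y int_h int_Yh int_g
      by (intro integral_mono) (simp_all add: e)
    moreover have "(\<integral>\<omega>'. c * (g \<omega> + g \<omega>') \<partial>M) = c * (g \<omega> + G)"
      using int_g by (simp add: G_def prob_space)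
    ultimately show ?thesis unfolding inner_zero_left by linarith
  qed
  have "(\<integral>\<omega>. Y \<omega> \<bullet> h \<omega> - Y \<omega> \<bullet> H + I \<partial>M) \<le> (\<integral>\<omega>. c * (g \<omega> + G) \<partial>M)"
    using inner int_Y int_h int_Yh int_g by (intro integral_mono) simp_all
  moreover have "(\<integral>\<omega>. Y \<omega> \<bullet> h \<omega> - Y \<omega> \<bullet> H + I \<partial>M) = I - 0 \<bullet> H + I"
    unfolding mean[symmetric] I_def using int_Y int_Yh by (simp add: prob_space)
  moreover have "(\<integral>\<omega>. c * (g \<omega> + G) \<partial>M) = c * (2 * G)"
    using int_g by (simp add: G_def prob_space)
  ultimately have "I \<le> c * G" unfolding inner_zero_left by linarith
  then show ?thesis by (simp add: I_def G_def c_def h_def g_def)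
qed

end

context prob_space
begin

text \<open>
  Split \<open>tr Z\<^bsup>2q+2\<^esup> = \<Sum>\<^sub>j tr Y\<^sub>j Z\<^bsup>2q+1\<^esup>\<close> and, in the \<open>j\<close>-th term, freeze the other summands, which are
  independent of \<open>Y\<^sub>j\<close>.
\<close>

lemma sum_moment_step:
  fixes Y :: "'i \<Rightarrow> 'a \<Rightarrow> 'c::real_or_complex^'d^'d"
    and J :: "'i set"
  defines "Z \<equiv> \<lambda>\<omega>. \<Sum>j\<in>J. Y j \<omega>"
  assumes fin: "finite J"
    and ind: "indep_vars (\<lambda>_. borel) Y J"
    and herm: "\<And>j \<omega>. j \<in> J \<Longrightarrow> \<omega> \<in> space M \<Longrightarrow> ctranspose (Y j \<omega>) = Y j \<omega>"
    and bound: "\<And>j \<omega>. j \<in> J \<Longrightarrow> \<omega> \<in> space M \<Longrightarrow> norm (Y j \<omega>) \<le> K"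
    and diff: "\<And>j \<omega> \<omega>' v. j \<in> J \<Longrightarrow> \<omega> \<in> space M \<Longrightarrow> \<omega>' \<in> space M \<Longrightarrow>
      norm ((Y j \<omega> - Y j \<omega>') *v v) \<le> 2 * norm v"
    and mean: "\<And>j. j \<in> J \<Longrightarrow> (\<integral>\<omega>. Y j \<omega> \<partial>M) = 0"
  shows "(\<integral>\<omega>. (norm (mpow (Z \<omega>) (Suc q)))\<^sup>2 \<partial>M) \<le>
    real (card J) * (2 * (2 * real q + 1)) * (\<integral>\<omega>. (norm (mpow (Z \<omega>) q))\<^sup>2 \<partial>M)"
proof -
  have Y [measurable]: "Y j \<in> borel_measurable M" if "j \<in> J" for j
    using ind that by (auto simp: indep_vars_def)
  have [measurable]: "Z \<in> borel_measurable M"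
    unfolding Z_def by (intro borel_measurable_sum Y)
  define c where "c = 2 * (2 * real q + 1)"
  have norm_sum: "norm (\<Sum>j\<in>I. Y j \<omega>) \<le> real (card I) * K" if "I \<subseteq> J" "\<omega> \<in> space M" for I \<omega>
    using that bound by (intro sum_norm_bound) auto
  have int_pow: "integrable M (\<lambda>\<omega>. B \<omega> \<bullet> mpow (C \<omega>) k)"
    if "B \<in> borel_measurable M" "C \<in> borel_measurable M"
      "\<And>\<omega>. \<omega> \<in> space M \<Longrightarrow> norm (B \<omega>) \<le> b" "\<And>\<omega>. \<omega> \<in> space M \<Longrightarrow> norm (C \<omega>) \<le> b'"
    for B C :: "'a \<Rightarrow> 'c^'d^'d" and b b' k
  proof (rule integrable_bounded)
    show "norm (B \<omega> \<bullet> mpow (C \<omega>) k) \<le> b * (b' ^ k * norm (mat 1 :: 'c^'d^'d))" if "\<omega> \<in> space M" for \<omega>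
    proof -
      have "norm (B \<omega> \<bullet> mpow (C \<omega>) k) \<le> norm (B \<omega>) * norm (mpow (C \<omega>) k)"
        by (simp add: Cauchy_Schwarz_ineq2)
      also have "\<dots> \<le> b * (b' ^ k * norm (mat 1 :: 'c^'d^'d))"
        using that \<open>\<And>\<omega>. \<omega> \<in> space M \<Longrightarrow> norm (B \<omega>) \<le> b\<close> \<open>\<And>\<omega>. \<omega> \<in> space M \<Longrightarrow> norm (C \<omega>) \<le> b'\<close>
        by (intro mult_mono norm_mpow_bound) (auto intro: order_trans[OF norm_ge_zero])
      finally show ?thesis .
    qed
  qed (use that in measurable)
  have summand: "integrable M (\<lambda>\<omega>. Y j \<omega> \<bullet> mpow (Z \<omega>) (2 * q + 1)) \<and>
      (\<integral>\<omega>. Y j \<omega> \<bullet> mpow (Z \<omega>) (2 * q + 1) \<partial>M) \<le> c * (\<integral>\<omega>. (norm (mpow (Z \<omega>) q))\<^sup>2 \<partial>M)"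
    if j: "j \<in> J" for j
  proof -
    define A where "A \<omega> = (\<Sum>i\<in>J - {j}. Y i \<omega>)" for \<omega>
    have Z: "Z \<omega> = A \<omega> + Y j \<omega>" for \<omega>
      unfolding Z_def A_def using j fin by (subst sum.remove[of J j]) auto
    have [measurable]: "A \<in> borel_measurable M"
      unfolding A_def by (intro borel_measurable_sum Y) auto
    note [measurable] = Y[OF j]
    have A_herm: "ctranspose (A \<omega>) = A \<omega>" if "\<omega> \<in> space M" for \<omega>
      unfolding A_def ctranspose_sum using herm that by (intro sum.cong) auto
    have "indep_var borel ((\<lambda>f. \<Sum>i\<in>J - {j}. f i) \<circ> (\<lambda>\<omega>. restrict (\<lambda>i. Y i \<omega>) (J - {j})))
        borel ((\<lambda>f. f j) \<circ> (\<lambda>\<omega>. restrict (\<lambda>i. Y i \<omega>) {j}))"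
      using j by (intro indep_var_compose[OF indep_var_restrict[OF ind]]) auto
    also have "(\<lambda>f. \<Sum>i\<in>J - {j}. f i) \<circ> (\<lambda>\<omega>. restrict (\<lambda>i. Y i \<omega>) (J - {j})) = A"
      by (auto simp: A_def fun_eq_iff)
    also have "(\<lambda>f. f j) \<circ> (\<lambda>\<omega>. restrict (\<lambda>i. Y i \<omega>) {j}) = Y j" by auto
    finally have AY: "indep_var borel A borel (Y j)" .
    have nZ: "norm (Z \<omega>) \<le> real (card J) * K" if "\<omega> \<in> space M" for \<omega>
      unfolding Z_def using norm_sum[OF order_refl that] .
    have nA: "norm (A \<omega>) \<le> real (card (J - {j})) * K" if "\<omega> \<in> space M" for \<omega>
      unfolding A_def using norm_sum[OF Diff_subset that] .
    define F where "F = (\<lambda>(a :: 'c^'d^'d, y). y \<bullet> mpow (a + y) (2 * q + 1))"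
    define G where "G = (\<lambda>(a :: 'c^'d^'d, y). (norm (mpow (a + y) q))\<^sup>2)"
    have F: "F \<in> borel_measurable borel" unfolding F_def
      by (rule borel_measurable_continuous_onI) (auto simp: case_prod_unfold intro!: continuous_intros)
    have G: "G \<in> borel_measurable borel" unfolding G_def
      by (rule borel_measurable_continuous_onI) (auto simp: case_prod_unfold intro!: continuous_intros)
    have int_F: "integrable M (\<lambda>\<omega>. F (A \<omega>, Y j \<omega>))"
      unfolding F_def using int_pow[of "Y j" Z K "real (card J) * K" "2 * q + 1"] bound[OF j] nZ
      by (simp add: Z[symmetric])
    have int_G: "integrable M (\<lambda>\<omega>. G (A \<omega>, Y j \<omega>))"
    proof (rule integrable_bounded)
      show "norm (G (A \<omega>, Y j \<omega>)) \<le> ((real (card J) * K) ^ q * norm (mat 1 :: 'c^'d^'d))\<^sup>2"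
        if "\<omega> \<in> space M" for \<omega>
        using norm_mpow_bound[OF nZ[OF that], of q] by (simp add: G_def Z[symmetric] power_mono)
    qed (simp add: G_def Z[symmetric])
    note itF = integral_indep_var_iterated[OF AY F int_F]
    note itG = integral_indep_var_iterated[OF AY G int_G]
    have "(\<integral>\<omega>. F (A \<omega>, Y j \<omega>) \<partial>M) = (\<integral>\<omega>'. (\<integral>\<omega>. F (A \<omega>', Y j \<omega>) \<partial>M) \<partial>M)"
      by (rule itF(1))
    also have "\<dots> \<le> (\<integral>\<omega>'. c * (\<integral>\<omega>. G (A \<omega>', Y j \<omega>) \<partial>M) \<partial>M)"
    proof (rule integral_mono)
      show "(\<integral>\<omega>. F (A \<omega>', Y j \<omega>) \<partial>M) \<le> c * (\<integral>\<omega>. G (A \<omega>', Y j \<omega>) \<partial>M)" if "\<omega>' \<in> space M" for \<omega>'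
        unfolding F_def G_def c_def prod.case
        by (rule one_summand_moment[where K = K]) (use that A_herm herm j bound diff mean Y in auto)
    qed (use itF itG in auto)
    also have "\<dots> = c * (\<integral>\<omega>. G (A \<omega>, Y j \<omega>) \<partial>M)" by (simp add: itG(1))
    finally show ?thesis using int_F by (simp add: F_def G_def Z[symmetric])
  qed
  have Z_herm: "ctranspose (Z \<omega>) = Z \<omega>" if "\<omega> \<in> space M" for \<omega>
    unfolding Z_def ctranspose_sum using herm that by (intro sum.cong) auto
  have "(\<integral>\<omega>. (norm (mpow (Z \<omega>) (Suc q)))\<^sup>2 \<partial>M) = (\<integral>\<omega>. (\<Sum>j\<in>J. Y j \<omega> \<bullet> mpow (Z \<omega>) (2 * q + 1)) \<partial>M)"
  proof (rule Bochner_Integration.integral_cong)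
    fix \<omega> assume "\<omega> \<in> space M"
    then have "(norm (mpow (Z \<omega>) (Suc q)))\<^sup>2 = Z \<omega> \<bullet> mpow (Z \<omega>) (2 * q + 1)"
      by (intro norm_mpow_squared Z_herm)
    also have "\<dots> = (\<Sum>j\<in>J. Y j \<omega> \<bullet> mpow (Z \<omega>) (2 * q + 1))"
      by (subst (1) Z_def) (rule inner_sum_left)
    finally show "(norm (mpow (Z \<omega>) (Suc q)))\<^sup>2 = (\<Sum>j\<in>J. Y j \<omega> \<bullet> mpow (Z \<omega>) (2 * q + 1))" .
  qed simp
  also have "\<dots> = (\<Sum>j\<in>J. (\<integral>\<omega>. Y j \<omega> \<bullet> mpow (Z \<omega>) (2 * q + 1) \<partial>M))"
    by (rule Bochner_Integration.integral_sum) (use summand in auto)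
  also have "\<dots> \<le> (\<Sum>j\<in>J. c * (\<integral>\<omega>. (norm (mpow (Z \<omega>) q))\<^sup>2 \<partial>M))"
    by (rule sum_mono) (use summand in auto)
  finally show ?thesis by (simp add: c_def)
qed

text \<open>
  Iterating the moment step gives \<open>E tr Z\<^bsup>2p\<^esup> / (2p)! \<le> d m\<^bsup>p\<^esup> / p!\<close>, where \<open>d\<close> is the dimension. Hence
  \<open>\<Sum>\<^sub>p \<theta>\<^bsup>2p\<^esup> tr Z\<^bsup>2p\<^esup> / (2p)!\<close> has mean at most \<open>d exp (\<theta>\<^sup>2 m)\<close>, while it is at least \<open>cosh (\<theta> \<parallel>Z\<parallel>)\<close>;
  Markov's inequality does the rest. Working with even moments bounds the norm of \<open>Z\<close>, not
  only its largest eigenvalue; the factor 2 is that of \<open>cosh u \<ge> exp u / 2\<close>.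
\<close>

lemma matrix_concentration:
  fixes Y :: "'i \<Rightarrow> 'a \<Rightarrow> 'c::real_or_complex^'d^'d"
    and J :: "'i set"
  defines "Z \<equiv> \<lambda>\<omega>. \<Sum>j\<in>J. Y j \<omega>"
  assumes fin: "finite J" and J: "J \<noteq> {}"
    and ind: "indep_vars (\<lambda>_. borel) Y J"
    and herm: "\<And>j \<omega>. j \<in> J \<Longrightarrow> \<omega> \<in> space M \<Longrightarrow> ctranspose (Y j \<omega>) = Y j \<omega>"
    and bound: "\<And>j \<omega>. j \<in> J \<Longrightarrow> \<omega> \<in> space M \<Longrightarrow> norm (Y j \<omega>) \<le> K"
    and diff: "\<And>j \<omega> \<omega>' v. j \<in> J \<Longrightarrow> \<omega> \<in> space M \<Longrightarrow> \<omega>' \<in> space M \<Longrightarrow>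
      norm ((Y j \<omega> - Y j \<omega>') *v v) \<le> 2 * norm v"
    and mean: "\<And>j. j \<in> J \<Longrightarrow> (\<integral>\<omega>. Y j \<omega> \<partial>M) = 0"
    and s: "s > 0"
  shows "\<exists>E\<in>events. E \<subseteq> {\<omega> \<in> space M. \<forall>v. norm v = 1 \<longrightarrow> norm (Z \<omega> *v v) < s} \<and>
    prob E \<ge> 1 - 2 * CARD('d) * exp (- s\<^sup>2 / (4 * card J))"
proof -
  define m where "m = real (card J)"
  have m: "m > 0" using fin J by (simp add: m_def card_gt_0_iff)
  \<comment> \<open>the minimizer of \<open>\<theta>\<^sup>2 m - \<theta> s\<close>\<close>
  define \<theta> where "\<theta> = s / (2 * m)"
  have \<theta>: "\<theta> > 0" using s m by (simp add: \<theta>_def)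
  have Y: "Y j \<in> borel_measurable M" if "j \<in> J" for j
    using ind that by (auto simp: indep_vars_def)
  have Z [measurable]: "Z \<in> borel_measurable M"
    unfolding Z_def by (intro borel_measurable_sum Y)
  have nZ: "norm (Z \<omega>) \<le> m * K" if "\<omega> \<in> space M" for \<omega>
    unfolding Z_def m_def using that bound by (intro sum_norm_bound) auto
  have Z_herm: "ctranspose (Z \<omega>) = Z \<omega>" if "\<omega> \<in> space M" for \<omega>
    unfolding Z_def ctranspose_sum using herm that by (intro sum.cong) auto
  define d where "d = (norm (mat 1 :: 'c^'d^'d))\<^sup>2"
  have d: "d = CARD('d)" unfolding d_def by (rule norm_mat1_squared)
  have int_norm: "integrable M (\<lambda>\<omega>. (norm (mpow (Z \<omega>) p))\<^sup>2)" for p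
  proof (rule integrable_bounded)
    show "norm ((norm (mpow (Z \<omega>) p))\<^sup>2) \<le> ((m * K) ^ p * norm (mat 1 :: 'c^'d^'d))\<^sup>2"
      if "\<omega> \<in> space M" for \<omega>
      using norm_mpow_bound[OF nZ[OF that], of p] by (simp add: power_mono)
  qed measurable
  define e where "e p = (\<integral>\<omega>. (norm (mpow (Z \<omega>) p))\<^sup>2 \<partial>M)" for p
  have e_le: "e p / fact (2 * p) \<le> d * m ^ p / fact p" for p
  proof (induction p)
    case 0
    show ?case by (simp add: e_def d_def prob_space)
  next
    case (Suc p)
    have f: "fact (2 * Suc p) = 2 * (real p + 1) * (2 * real p + 1) * fact (2 * p)"
      by (simp add: algebra_simps)
    have "e (Suc p) \<le> m * (2 * (2 * real p + 1)) * e p"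
      unfolding e_def m_def Z_def
      by (rule sum_moment_step[OF fin ind]) (use herm bound diff mean in auto)
    then have "e (Suc p) / fact (2 * Suc p) \<le> m * (2 * (2 * real p + 1)) * e p / fact (2 * Suc p)"
      by (intro divide_right_mono) auto
    also have "\<dots> = (m / (real p + 1)) * (e p / fact (2 * p))"
    proof -
      have "m * (2 * x) * y / (2 * z * x * f) = m / z * (y / f)" if "x \<noteq> 0" "z \<noteq> 0" for x y z f :: real
        using that by (simp add: field_simps)
      then show ?thesis unfolding f by (metis add_pos_nonneg less_irrefl mult_nonneg_nonneg of_nat_0_le_iff
        zero_le_numeral zero_less_one add.commute)
    qed
    also have "\<dots> \<le> (m / (real p + 1)) * (d * m ^ p / fact p)"
      using m by (intro mult_left_mono Suc) auto
    also have "\<dots> = d * m ^ Suc p / fact (Suc p)" by (simp add: field_simps)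
    finally show ?case .
  qed
  define a where "a p \<omega> = \<theta> ^ (2 * p) / fact (2 * p) * (norm (mpow (Z \<omega>) p))\<^sup>2" for p \<omega>
  have a_nonneg: "a p \<omega> \<ge> 0" for p \<omega> by (simp add: a_def \<theta>)
  have int_a: "integrable M (a p)" for p unfolding a_def using int_norm by simp
  have a_le: "(\<integral>\<omega>. a p \<omega> \<partial>M) \<le> d * ((\<theta>\<^sup>2 * m) ^ p / fact p)" for p
  proof -
    have "(\<integral>\<omega>. a p \<omega> \<partial>M) = \<theta> ^ (2 * p) * (e p / fact (2 * p))" by (simp add: a_def e_def)
    also have "\<dots> \<le> \<theta> ^ (2 * p) * (d * m ^ p / fact p)" using \<theta> by (intro mult_left_mono e_le) auto
    also have "\<dots> = d * ((\<theta>\<^sup>2 * m) ^ p / fact p)"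
      unfolding power_mult[of \<theta> 2 p] power_mult_distrib by (simp only: times_divide_eq_right mult_ac)
    finally show ?thesis .
  qed
  have exp_sums: "(\<lambda>p. d * ((\<theta>\<^sup>2 * m) ^ p / fact p)) sums (d * exp (\<theta>\<^sup>2 * m))"
    using sums_mult[OF exp_converges[of "\<theta>\<^sup>2 * m"], of d] by (simp add: divide_inverse mult_ac)
  have cosh_sums: "(\<lambda>p. x ^ (2 * p) / fact (2 * p)) sums cosh x" for x :: real
  proof -
    have "(\<lambda>p. (\<lambda>n. if even n then x ^ n /\<^sub>R fact n else 0) (2 * p)) sums cosh x"
      by (subst sums_mono_reindex) (auto simp: cosh_converges strict_mono_def elim!: evenE)
    then show ?thesis by (simp add: divide_inverse mult.commute)
  qed
  have summable_a: "summable (\<lambda>p. a p \<omega>)" for \<omega>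
  proof (rule summable_comparison_test'[where g = "\<lambda>p. d * ((\<theta> * norm (Z \<omega>)) ^ (2 * p) / fact (2 * p))"])
    show "summable (\<lambda>p. d * ((\<theta> * norm (Z \<omega>)) ^ (2 * p) / fact (2 * p)))"
      using sums_summable[OF cosh_sums] by (rule summable_mult)
    show "norm (a p \<omega>) \<le> d * ((\<theta> * norm (Z \<omega>)) ^ (2 * p) / fact (2 * p))" for p
    proof -
      have "(norm (mpow (Z \<omega>) p))\<^sup>2 \<le> (norm (Z \<omega>) ^ p * norm (mat 1 :: 'c^'d^'d))\<^sup>2"
        by (intro power_mono norm_mpow_le) auto
      also have "\<dots> = d * norm (Z \<omega>) ^ (2 * p)"
        by (simp add: d_def power_mult_distrib power_mult[symmetric] mult.commute)
      finally have "a p \<omega> \<le> \<theta> ^ (2 * p) / fact (2 * p) * (d * norm (Z \<omega>) ^ (2 * p))"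
        unfolding a_def using \<theta> by (intro mult_left_mono) auto
      then show ?thesis using a_nonneg by (simp add: power_mult_distrib mult_ac)
    qed
  qed
  have summable_int: "summable (\<lambda>p. \<integral>\<omega>. norm (a p \<omega>) \<partial>M)"
    by (rule summable_comparison_test'[OF sums_summable[OF exp_sums], of 0])
      (use a_le a_nonneg in \<open>auto simp: integral_nonneg_AE\<close>)
  define S where "S \<omega> = (\<Sum>p. a p \<omega>)" for \<omega>
  have int_S: "integrable M S" unfolding S_def
    by (rule integrable_suminf[OF int_a _ summable_int]) (use summable_a a_nonneg in simp)
  have "(\<integral>\<omega>. S \<omega> \<partial>M) = (\<Sum>p. \<integral>\<omega>. a p \<omega> \<partial>M)" unfolding S_def
    by (rule integral_suminf[OF int_a _ summable_int]) (use summable_a a_nonneg in simp)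
  also have "\<dots> \<le> (\<Sum>p. d * ((\<theta>\<^sup>2 * m) ^ p / fact p))"
    by (rule suminf_le[OF a_le _ sums_summable[OF exp_sums]])
      (use summable_int a_nonneg in simp)
  also have "\<dots> = d * exp (\<theta>\<^sup>2 * m)" using exp_sums by (simp add: sums_iff)
  finally have S_le: "(\<integral>\<omega>. S \<omega> \<partial>M) \<le> d * exp (\<theta>\<^sup>2 * m)" .
  define t where "t = exp (\<theta> * s) / 2"
  define E where "E = {\<omega> \<in> space M. S \<omega> < t}"
  note [measurable] = borel_measurable_integrable[OF int_S]
  have E: "E \<in> events" unfolding E_def by measurable
  have "prob (space M - E) = prob {\<omega> \<in> space M. S \<omega> \<ge> t}"
    by (rule arg_cong[where f = prob]) (auto simp: E_def)
  also have "\<dots> \<le> (\<integral>\<omega>. S \<omega> \<partial>M) / t"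
    by (rule integral_Markov_inequality_measure[OF int_S, of "{}"])
      (auto simp: t_def S_def intro!: suminf_nonneg summable_a a_nonneg)
  also have "\<dots> \<le> d * exp (\<theta>\<^sup>2 * m) / t" by (intro divide_right_mono S_le) (simp add: t_def)
  also have "\<dots> = 2 * d * exp (\<theta>\<^sup>2 * m - \<theta> * s)" by (simp add: t_def exp_diff)
  also have "\<theta>\<^sup>2 * m - \<theta> * s = - s\<^sup>2 / (4 * m)"
    using m by (simp add: \<theta>_def power2_eq_square field_simps)
  finally have "prob E \<ge> 1 - 2 * d * exp (- s\<^sup>2 / (4 * m))"
    using prob_compl[OF E] by simp
  moreover have "norm (Z \<omega> *v v) < s" if w: "\<omega> \<in> E" and v: "norm v = 1" for \<omega> v
  proof -
    define x where "x = norm (Z \<omega> *v v)"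
    have "cosh (\<theta> * x) = (\<Sum>p. (\<theta> * x) ^ (2 * p) / fact (2 * p))"
      using cosh_sums by (simp add: sums_iff)
    also have "\<dots> \<le> S \<omega>" unfolding S_def
    proof (rule suminf_le[OF _ sums_summable[OF cosh_sums] summable_a])
      fix p
      have "(x ^ p)\<^sup>2 \<le> (norm (mpow (Z \<omega>) p))\<^sup>2"
        unfolding x_def using w by (intro power_mono norm_mv_power_le Z_herm v) (auto simp: E_def)
      then have "\<theta> ^ (2 * p) / fact (2 * p) * (x ^ p)\<^sup>2 \<le> a p \<omega>"
        unfolding a_def using \<theta> by (intro mult_left_mono) auto
      then show "(\<theta> * x) ^ (2 * p) / fact (2 * p) \<le> a p \<omega>"
        by (simp add: power_mult_distrib power_mult[symmetric] mult_ac)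
    qed
    also have "\<dots> < t" using w by (simp add: E_def)
    also have "\<dots> \<le> cosh (\<theta> * s)" by (simp add: t_def cosh_def)
    finally have "\<theta> * x < \<theta> * s"
      using \<theta> s by (subst (asm) cosh_real_nonneg_less_iff) (auto simp: x_def)
    then show ?thesis using \<theta> by (simp add: x_def)
  qed
  ultimately show ?thesis using E unfolding d m_def by (intro bexI[of _ E]) (auto simp: E_def)
qed

end

section \<open>The Hermitian form and orthogonal projections\<close>

text \<open>
  The scalar-valued Hermitian form, linear in the first argument; the inner product of the library is
  its real part. Over the complex numbers, orthogonality in the sense of \<open>hip\<close> is the stronger notion.
\<close>

definition hip :: "'a::real_or_complex^'d \<Rightarrow> 'a^'d \<Rightarrow> 'a" where
  "hip v w = (\<Sum>i\<in>UNIV. v $ i * conjugate (w $ i))"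

lemma real_part_hip: "real_part (hip v w) = v \<bullet> w"
  by (simp add: hip_def inner_vec_def real_part_sum inner_eq_real_part)

lemma hip_simps [simp]:
  fixes v w :: "'a::real_or_complex^'d"
  shows hip_add_left: "hip (v + v') w = hip v w + hip v' w"
    and hip_add_right: "hip v (w + w') = hip v w + hip v w'"
    and hip_diff_left: "hip (v - v') w = hip v w - hip v' w"
    and hip_diff_right: "hip v (w - w') = hip v w - hip v w'"
    and hip_scaleR_left: "hip (r *\<^sub>R v) w = r *\<^sub>R hip v w"
    and hip_scaleR_right: "hip v (r *\<^sub>R w) = r *\<^sub>R hip v w"
    and hip_scale_left: "hip (c *s v) w = c * hip v w"
    and hip_scale_right: "hip v (c *s w) = conjugate c * hip v w"
    and hip_zero_left: "hip 0 w = 0"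
  by (simp_all add: hip_def algebra_simps sum.distrib sum_subtractf scaleR_sum_right
      sum_distrib_left conjugate_add conjugate_mult)

lemma conjugate_hip: "conjugate (hip v w) = hip w v"
  by (simp add: hip_def conjugate_sum conjugate_mult mult.commute)

lemma hip_self: "hip v v = of_real ((norm v)\<^sup>2)"
  by (simp only: hip_def mult_conjugate power2_norm_eq_inner inner_vec_def of_real_sum)

lemma hip_mv_left: "hip (A *v v) w = hip v (ctranspose A *v w)"
  for A :: "'a::real_or_complex^'n^'m"
proof -
  have "hip (A *v v) w = (\<Sum>i\<in>UNIV. \<Sum>j\<in>UNIV. A $ i $ j * v $ j * conjugate (w $ i))"
    by (simp add: hip_def matrix_vector_mult_def sum_distrib_right)
  also have "\<dots> = (\<Sum>j\<in>UNIV. \<Sum>i\<in>UNIV. A $ i $ j * v $ j * conjugate (w $ i))"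
    by (rule sum.swap)
  also have "\<dots> = hip v (ctranspose A *v w)"
    by (simp add: hip_def matrix_vector_mult_def conjugate_sum conjugate_mult sum_distrib_left mult_ac)
  finally show ?thesis .
qed

lemma eq_of_real_if_self_conjugate: "conjugate z = z \<Longrightarrow> z = of_real (real_part z)"
  for z :: "'a::real_or_complex"
proof -
  assume "conjugate z = z"
  then have "2 *\<^sub>R z = 2 *\<^sub>R (of_real (real_part z))"
    unfolding conjugate_def by (simp add: scaleR_conv_of_real)
  then show ?thesis by simp
qed

lemma hip_hermitian: "ctranspose A = A \<Longrightarrow> hip (A *v x) x = of_real ((A *v x) \<bullet> x)"
  by (metis eq_of_real_if_self_conjugate conjugate_hip hip_mv_left real_part_hip)

lemma scale_of_real: "(of_real r :: 'a) *s v = r *\<^sub>R v" for v :: "'a::real_or_complex^'d"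
  by (simp add: vec_eq_iff) (simp add: scaleR_conv_of_real)

lemma norm_scale: "norm (c *s v) = norm c * norm v" for v :: "'a::real_or_complex^'d"
proof -
  have "(norm (c *s v))\<^sup>2 = (norm c * norm v)\<^sup>2"
    by (simp only: power2_norm_eq_inner inner_vec_def vector_smult_component inner_mult_both
        sum_distrib_left[symmetric] power_mult_distrib)
  then show ?thesis by (simp add: power2_eq_iff_nonneg)
qed

definition outer :: "'a::real_or_complex^'d \<Rightarrow> 'a^'d^'d" where
  "outer x = (\<chi> i j. x $ i * conjugate (x $ j))"

lemma outer_mv [simp]: "outer x *v v = hip v x *s x"
  by (simp add: vec_eq_iff outer_def matrix_vector_mult_def hip_def sum_distrib_left mult_ac)

lemma ctranspose_outer [simp]: "ctranspose (outer x) = outer x"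
  by (simp add: vec_eq_iff outer_def conjugate_mult mult.commute)

lemma inner_outer: "A \<bullet> outer x = (A *v x) \<bullet> x"
proof -
  have "a \<bullet> (x $ i * conjugate (x $ j)) = (a * x $ j) \<bullet> x $ i" for a i j
    by (simp add: inner_eq_real_part conjugate_mult mult_ac)
  then show ?thesis
    by (simp add: inner_vec_def[where 'a = "'a^'d"] inner_vec_def[where 'a = 'a] outer_def
        matrix_vector_mult_def inner_sum_left)
qed

lemma mult_outer: "A ** outer x = (\<chi> i j. (A *v x) $ i * conjugate (x $ j))"
  by (simp add: vec_eq_iff outer_def matrix_matrix_mult_def matrix_vector_mult_def
      sum_distrib_left mult_ac)

lemma outer_square: "norm x = 1 \<Longrightarrow> outer x ** outer x = outer x"
  by (simp add: mult_outer hip_self) (simp add: outer_def)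

lemma matrix_inner_self: "A \<bullet> mat 1 = real_part (trace A)" for A :: "'a::real_or_complex^'d^'d"
  using real_part_trace_mult[of A "mat 1"] by simp

lemma projection_minus_outer:
  fixes P :: "'a::real_or_complex^'d^'d"
  assumes P: "ctranspose P = P" "P ** P = P" and x: "P *v x = x" "norm x = 1"
  defines "P' \<equiv> P - outer x"
  shows "ctranspose P' = P'" "P' ** P' = P'" "P ** P' = P'" "P' *v x = 0" "real_part (trace P') = real_part (trace P) - 1"
proof -
  have Po: "P ** outer x = outer x" by (simp add: mult_outer x) (simp add: outer_def)
  then have oP: "outer x ** P = outer x"
    using ctranspose_mult[of P "outer x"] P by simp
  show "ctranspose P' = P'" by (simp add: P'_def P)
  show "P' ** P' = P'" "P ** P' = P'"
    by (simp_all add: P'_def matrix_mult_linear P Po oP outer_square x)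
  show "P' *v x = 0" by (simp add: P'_def mv_diff_left x hip_self)
  have "outer x \<bullet> mat 1 = 1"
    using x by (simp add: inner_commute[of "outer x"] inner_outer dot_square_norm)
  then show "real_part (trace P') = real_part (trace P) - 1"
    by (simp add: P'_def matrix_inner_self[symmetric] inner_diff_left)
qed

lemma projection_fixed_vector:
  fixes P :: "'a::real_or_complex^'d^'d"
  assumes "P ** P = P" "P \<noteq> 0"
  obtains x where "P *v x = x" "norm x = 1"
proof -
  from assms(2) obtain v where v: "P *v v \<noteq> 0" by (metis matrix_eq matrix_vector_mult_0)
  show thesis
  proof
    show "P *v ((1 / norm (P *v v)) *\<^sub>R (P *v v)) = (1 / norm (P *v v)) *\<^sub>R (P *v v)"
      by (simp add: mv_scaleR_right matrix_vector_mul_assoc assms(1))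
    show "norm ((1 / norm (P *v v)) *\<^sub>R (P *v v)) = 1" using v by simp
  qed
qed

text \<open>
  Subtracting \<open>x x*\<close> for a unit vector \<open>x\<close> in the range lowers both the trace and the dimension by one.
\<close>

lemma trace_projection_eq_dim_range:
  fixes P :: "'a::real_or_complex^'d^'d"
  assumes "ctranspose P = P" "P ** P = P"
  shows "real_part (trace P) = vec.dim (range ((*v) P))"
  using assms
proof (induction "vec.dim (range ((*v) P))" arbitrary: P rule: less_induct)
  case (less P)
  show ?case
  proof (cases "P = 0")
    case True
    then show ?thesis by (simp add: trace_def vec.dim_insert image_constant_conv)
  next
    case False
    then obtain x where x: "P *v x = x" "norm x = 1"
      using projection_fixed_vector less.prems by blast
    define P' where "P' = P - outer x"
    note P' = projection_minus_outer[OF less.prems x, folded P'_def]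
    have sub: "vec.subspace (range ((*v) A))" for A :: "'a^'d^'d"
      by (auto simp: vec.subspace_def mv_add_right[symmetric] mv_scale_right[symmetric]
          intro: image_eqI[of _ _ 0])
    have "x \<notin> range ((*v) P')"
    proof
      assume "x \<in> range ((*v) P')"
      then obtain v where "x = P' *v v" by blast
      then have "P' *v x = x" by (metis matrix_vector_mul_assoc P'(2))
      then show False using P'(4) x by simp
    qed
    then have dim: "vec.dim (insert x (range ((*v) P'))) = vec.dim (range ((*v) P')) + 1"
      using sub by (simp add: vec.dim_insert vec.span_eq_iff[THEN iffD2])
    have "vec.span (insert x (range ((*v) P'))) = range ((*v) P)"
    proof
      have "P' *v v \<in> range ((*v) P)" for v
        by (rule image_eqI[of _ _ "P' *v v"]) (simp_all add: matrix_vector_mul_assoc P')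
      then show "vec.span (insert x (range ((*v) P'))) \<subseteq> range ((*v) P)"
        using x(1)[symmetric] by (intro vec.span_minimal sub) auto
      have "P *v v = P' *v v + hip v x *s x" for v by (simp add: P'_def mv_diff_left)
      then show "range ((*v) P) \<subseteq> vec.span (insert x (range ((*v) P')))"
        by (auto intro!: vec.span_add vec.span_scale intro: vec.span_base)
    qed
    then have "vec.dim (range ((*v) P)) = vec.dim (range ((*v) P')) + 1"
      using dim by (metis vec.dim_span)
    then show ?thesis using less.hyps[of P'] P' by simp
  qed
qed

text \<open>
  The rank is the dimension of the row space, that is, of the range of the transpose, which is again
  an orthogonal projection and has the same trace.
\<close>

lemma trace_projection_eq_rank:
  fixes P :: "'a::real_or_complex^'d^'d"
  assumes "ctranspose P = P" "P ** P = P"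
  shows "real_part (trace P) = rank P"
proof -
  let ?Q = "transpose P"
  have "ctranspose ?Q = ?Q"
    using assms(1) by (simp add: vec_eq_iff transpose_def)
  moreover have "?Q ** ?Q = ?Q"
    using assms(2) by (metis matrix_transpose_mul)
  ultimately have "real_part (trace ?Q) = vec.dim (range ((*v) ?Q))"
    by (rule trace_projection_eq_dim_range)
  also have "vec.dim (range ((*v) ?Q)) = vec.dim (columns ?Q)"
  proof -
    have "column i A = A *v axis i 1" for i and A :: "'a^'d^'d"
      by (simp add: vec_eq_iff matrix_vector_mult_def column_def axis_def if_distrib cong: if_cong)
    then have "columns ?Q \<subseteq> range ((*v) ?Q)" by (auto simp: columns_def)
    moreover have "range ((*v) ?Q) \<subseteq> vec.span (columns ?Q)"
      using matrix_vector_mult_in_columnspace_gen by blast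
    ultimately show ?thesis
      by (metis vec.dim_span vec.dim_subset le_antisym)
  qed
  moreover have "trace ?Q = trace P" by (simp add: trace_def transpose_def)
  ultimately show ?thesis by (simp add: row_rank_def_gen columns_transpose)
qed

text \<open>
  With the trace in place of the rank, membership is visibly stable under unitary conjugation.
\<close>

lemma Proj_iff:
  "P \<in> Proj k \<longleftrightarrow> ctranspose P = P \<and> P ** P = P \<and> P \<bullet> mat 1 = real k"
  unfolding Proj_def mem_Collect_eq matrix_inner_self
  using trace_projection_eq_rank[of P] by auto

lemma rank_one_projection:
  assumes "X \<in> Proj 1"
  obtains x where "norm x = 1" "X = outer x"
proof -
  have X: "ctranspose X = X" "X ** X = X" "X \<bullet> mat 1 = 1" using assms by (auto simp: Proj_iff)
  then have "X \<noteq> 0" by auto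
  then obtain x where x: "X *v x = x" "norm x = 1" using projection_fixed_vector X by blast
  note X' = projection_minus_outer[OF X(1,2) x]
  have "(X - outer x) \<bullet> (X - outer x) = ((X - outer x) ** (X - outer x)) \<bullet> mat 1"
    by (simp add: inner_matrix_mult_right X)
  also have "\<dots> = 0" unfolding X'(2) using X' X(3) by (simp add: matrix_inner_self)
  finally have "X = outer x" by simp
  with x(2) show thesis by (rule that)
qed

lemma outer_in_Proj: "norm x = 1 \<Longrightarrow> outer x \<in> Proj 1"
  by (simp add: Proj_iff outer_square inner_commute[of "outer x"] inner_outer dot_square_norm)

text \<open>
  For a unit vector \<open>w\<close> this is the unitary map that negates \<open>w\<close> and fixes its orthogonal complement.
  These are the only unitary matrices at which invariance is used.
\<close>

definition householder :: "'a::real_or_complex^'d \<Rightarrow> 'a^'d^'d" where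
  "householder w = mat 1 - outer w - outer w"

lemma householder_mv: "householder w *v v = v - (2 * hip v w) *s w"
  by (simp only: householder_def mv_diff_left outer_mv matrix_vector_mul_lid)
    (simp add: vec_eq_iff algebra_simps)

lemma ctranspose_householder [simp]: "ctranspose (householder w) = householder w"
  by (simp only: householder_def ctranspose_diff ctranspose_mat1 ctranspose_outer)

lemma householder_square: "norm w = 1 \<Longrightarrow> householder w ** householder w = mat 1"
  unfolding matrix_eq matrix_vector_mul_assoc[symmetric] householder_mv
  by (simp add: hip_self vec_eq_iff algebra_simps)

lemma unitary_householder: "norm w = 1 \<Longrightarrow> unitary (householder w)"
  by (simp add: unitary_def householder_square)

lemma unitary_conjugation_Proj:
  assumes U: "unitary U" and P: "P \<in> Proj k"
  shows "U ** P ** ctranspose U \<in> Proj k"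
proof -
  have "U ** P ** ctranspose U ** (U ** P ** ctranspose U) =
      U ** (P ** (ctranspose U ** U) ** P) ** ctranspose U"
    by (simp only: matrix_mul_assoc)
  also have "\<dots> = U ** P ** ctranspose U" using U P by (simp add: unitary_def Proj_iff)
  finally have "U ** P ** ctranspose U ** (U ** P ** ctranspose U) = U ** P ** ctranspose U" .
  moreover have "(U ** P ** ctranspose U) \<bullet> mat 1 = P \<bullet> mat 1"
    using U by (simp only: inner_matrix_mult_right[of "U ** P"] inner_matrix_mult_left[of U]
        unitary_def ctranspose_ctranspose matrix_mul_lid)
  ultimately show ?thesis using P
    by (simp add: Proj_iff ctranspose_mult matrix_mul_assoc)
qed

text \<open>
  Pushing a measure forward is meaningful only along a measurable map, so conjugation by a
  unitary matrix has to be seen to map projections of rank \<open>n\<close> to such projections.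
\<close>

lemma uniform_proj_invariance:
  fixes P :: "'w \<Rightarrow> 'a::real_or_complex^'d^'d"
    and F :: "'a^'d^'d \<Rightarrow> 'b::{banach, second_countable_topology}"
  assumes P: "P \<in> measurable M (proj_space n)"
    and unif: "uniform_proj_measure n (distr M (proj_space n) P)"
    and U: "unitary U" and F: "F \<in> borel_measurable borel"
  shows "(\<integral>\<omega>. F (U ** P \<omega> ** ctranspose U) \<partial>M) = (\<integral>\<omega>. F (P \<omega>) \<partial>M)"
proof -
  let ?N = "distr M (proj_space n) P" and ?c = "\<lambda>P. U ** P ** ctranspose U"
  have c: "?c \<in> measurable (proj_space n) (proj_space n)"
    unfolding proj_space_def
  proof (rule measurable_restrict_space2)
    show "?c \<in> space (restrict_space borel (Proj n)) \<rightarrow> Proj n"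
      using unitary_conjugation_Proj[OF U] by (auto simp: space_restrict_space)
    have "?c \<in> borel_measurable borel"
      by (intro borel_measurable_continuous_onI continuous_intros)
    then show "?c \<in> restrict_space borel (Proj n) \<rightarrow>\<^sub>M borel" by (rule measurable_restrict_space1)
  qed
  have F': "F \<in> borel_measurable (proj_space n)"
    unfolding proj_space_def using F by (rule measurable_restrict_space1)
  have "(\<integral>\<omega>. F (P \<omega>) \<partial>M) = (\<integral>Q. F Q \<partial>?N)" by (rule integral_distr[OF P F', symmetric])
  also have "?N = distr ?N (proj_space n) ?c"
    using unif U by (simp add: uniform_proj_measure_def)
  also have "(\<integral>Q. F Q \<partial>distr ?N (proj_space n) ?c) = (\<integral>Q. F (?c Q) \<partial>?N)"
    by (rule integral_distr) (use c F' in auto)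
  also have "\<dots> = (\<integral>\<omega>. F (?c (P \<omega>)) \<partial>M)"
    by (rule integral_distr[OF P]) (rule measurable_compose[OF c F'])
  finally show ?thesis ..
qed

text \<open>
  The trace over the real vector space underlying the space of vectors counts each scalar direction
  separately, whence the factor \<open>DIM('a)\<close>.
\<close>

lemma sum_Basis_matrix_inner:
  fixes A B :: "'a::real_or_complex^'d^'d"
  shows "(\<Sum>b\<in>Basis. (A *v b) \<bullet> (B *v b)) = DIM('a) * (A \<bullet> B)"
proof -
  have inj: "inj_on (\<lambda>(i, c). axis i c :: 'a^'d) (UNIV \<times> Basis)"
    by (auto simp: inj_on_def axis_eq_axis)
  have Basis: "(Basis :: ('a^'d) set) = (\<lambda>(i, c). axis i c) ` (UNIV \<times> Basis)"
    by (auto simp: Basis_vec_def)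
  have "(A *v axis i c) \<bullet> (B *v axis i c) = column i A \<bullet> column i B" if "c \<in> Basis" for i c
  proof -
    have ax: "C *v axis i c = c *s column i C" for C :: "'a^'d^'d"
      by (simp add: vec_eq_iff matrix_vector_mult_def column_def axis_def if_distrib mult.commute
          cong: if_cong)
    show ?thesis using that
      by (simp add: ax inner_vec_def inner_mult_both)
  qed
  then have "(\<Sum>b\<in>Basis. (A *v b) \<bullet> (B *v b)) = (\<Sum>(i, c)\<in>UNIV \<times> (Basis :: 'a set). column i A \<bullet> column i B)"
    unfolding Basis by (subst sum.reindex[OF inj]) (auto intro!: sum.cong)
  also have "\<dots> = (\<Sum>i\<in>UNIV. \<Sum>c\<in>(Basis :: 'a set). column i A \<bullet> column i B)"
    by (rule sum.cartesian_product[symmetric])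
  also have "\<dots> = DIM('a) * (A \<bullet> B)" by (simp add: inner_matrix_columns[of A B] sum_distrib_left)
  finally show ?thesis .
qed

text \<open>
  A real orthonormal basis of the complement of the line spanned by \<open>x\<close> over the scalars. Its
  defining equation says that the orthogonal projection onto this complement is \<open>1 - x x*\<close>.
\<close>

lemma orthonormal_complement_basis:
  fixes x :: "'a::real_or_complex^'d"
  assumes x: "norm x = 1"
  obtains C where "finite C" "\<And>y. y \<in> C \<Longrightarrow> norm y = 1 \<and> hip y x = 0" "pairwise orthogonal C"
    "\<And>v. (\<Sum>y\<in>C. (v \<bullet> y) *\<^sub>R y) = v - hip v x *s x"
proof -
  define W where "W = {v. hip v x = 0}"
  have "subspace W" by (auto simp: W_def subspace_def)
  then obtain C where C: "C \<subseteq> W" "pairwise orthogonal C" "\<And>y. y \<in> C \<Longrightarrow> norm y = 1"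
      "independent C" "card C = dim W" "span C = W"
    by (rule orthonormal_basis_subspace) blast
  have fin: "finite C" using C(4) by (rule independent_imp_finite)
  have "(\<Sum>y\<in>C. (v \<bullet> y) *\<^sub>R y) = v - hip v x *s x" for v
  proof -
    have 0: "(hip v x *s x) \<bullet> y = 0" if "y \<in> C" for y
    proof -
      have "hip x y = conjugate (hip y x)" by (simp add: conjugate_hip)
      then have "hip (hip v x *s x) y = 0" using that C(1) by (auto simp: W_def)
      then show ?thesis by (metis real_part_hip real_part_0)
    qed
    have "v - hip v x *s x \<in> span C" unfolding C(6) W_def using x by (simp add: hip_self)
    then have "(\<Sum>y\<in>C. ((v - hip v x *s x) \<bullet> y) *\<^sub>R y) = v - hip v x *s x"
      by (intro orthonormal_basis_expand C(2,3) fin)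
    then show ?thesis using 0 by (simp add: inner_diff_left)
  qed
  with fin C show thesis by (intro that) (auto simp: W_def)
qed

lemma sum_complement_basis:
  fixes x :: "'a::real_or_complex^'d" and A :: "'a^'d^'d"
  assumes C: "finite C" "\<And>v. (\<Sum>y\<in>C. (v \<bullet> y) *\<^sub>R y) = v - hip v x *s x"
  shows "(\<Sum>y\<in>C. (A *v y) \<bullet> y) = DIM('a) * (A \<bullet> mat 1 - (A *v x) \<bullet> x)"
    and "(\<Sum>y\<in>C. (v \<bullet> y)\<^sup>2) = v \<bullet> v - (norm (hip v x))\<^sup>2"
proof -
  have L: "linear (\<lambda>v. A *v v)" by (rule linear_mv)
  have "(\<Sum>y\<in>C. (A *v y) \<bullet> y) = (\<Sum>y\<in>C. \<Sum>b\<in>Basis. (A *v b) \<bullet> ((b \<bullet> y) *\<^sub>R y))"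
  proof (rule sum.cong)
    fix y
    have "A *v y = A *v (\<Sum>b\<in>Basis. (y \<bullet> b) *\<^sub>R b)" by (simp only: euclidean_representation)
    also have "\<dots> = (\<Sum>b\<in>Basis. (y \<bullet> b) *\<^sub>R (A *v b))"
      by (simp add: linear_sum[OF L] mv_scaleR_right)
    finally show "(A *v y) \<bullet> y = (\<Sum>b\<in>Basis. (A *v b) \<bullet> ((b \<bullet> y) *\<^sub>R y))"
      by (simp only: inner_sum_left inner_scaleR_left inner_scaleR_right inner_commute[of y])
  qed simp
  also have "\<dots> = (\<Sum>b\<in>Basis. (A *v b) \<bullet> (\<Sum>y\<in>C. (b \<bullet> y) *\<^sub>R y))"
    by (subst sum.swap) (simp add: inner_sum_right)
  also have "\<dots> = (\<Sum>b\<in>Basis. (A *v b) \<bullet> (mat 1 *v b)) - (\<Sum>b\<in>Basis. (A *v b) \<bullet> (outer x *v b))"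
    by (simp add: C(2) inner_diff_right sum_subtractf)
  also have "\<dots> = DIM('a) * (A \<bullet> mat 1 - (A *v x) \<bullet> x)"
    unfolding sum_Basis_matrix_inner inner_outer by (simp add: right_diff_distrib)
  finally show "(\<Sum>y\<in>C. (A *v y) \<bullet> y) = DIM('a) * (A \<bullet> mat 1 - (A *v x) \<bullet> x)" .
  have "(\<Sum>y\<in>C. (v \<bullet> y)\<^sup>2) = v \<bullet> (\<Sum>y\<in>C. (v \<bullet> y) *\<^sub>R y)"
    by (simp add: inner_sum_right power2_eq_square)
  also have "\<dots> = v \<bullet> v - real_part (conjugate (hip v x) * hip v x)"
    by (simp only: C(2) inner_diff_right real_part_hip[symmetric, of v "hip v x *s x"] hip_scale_right)
  also have "conjugate (hip v x) * hip v x = of_real ((norm (hip v x))\<^sup>2)"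
    by (simp add: mult.commute mult_conjugate)
  finally show "(\<Sum>y\<in>C. (v \<bullet> y)\<^sup>2) = v \<bullet> v - (norm (hip v x))\<^sup>2" by (simp del: of_real_power)
qed

section \<open>The distribution of a uniform random projection at a fixed vector\<close>

text \<open>
  The reflection \<open>2 P - 1\<close>.
\<close>

definition refl :: "'a::real_or_complex^'d^'d \<Rightarrow> 'a^'d^'d" where
  "refl P = P - (mat 1 - P)"

lemma ctranspose_refl: "ctranspose P = P \<Longrightarrow> ctranspose (refl P) = refl P"
  by (simp only: refl_def ctranspose_diff ctranspose_mat1)

lemma refl_square:
  assumes "P ** P = P"
  shows "refl P ** refl P = mat 1"
proof -
  have PQ: "P ** (mat 1 - P) = 0" "(mat 1 - P) ** P = 0" "(mat 1 - P) ** (mat 1 - P) = mat 1 - P"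
    by (simp_all add: matrix_mult_linear assms)
  show ?thesis by (simp only: refl_def matrix_mult_diff_left[of P] matrix_mult_diff_right[of _ P] PQ assms)
    (simp add: algebra_simps)
qed

lemma norm_refl_mv:
  assumes "ctranspose P = P" "P ** P = P"
  shows "norm (refl P *v v) = norm v"
proof -
  have "(refl P *v v) \<bullet> (refl P *v v) = v \<bullet> v"
    by (subst inner_mv_left) (simp add: ctranspose_refl refl_square assms matrix_vector_mul_assoc)
  then show ?thesis by (simp add: norm_eq_sqrt_inner)
qed

lemma refl_conjugation:
  assumes "unitary U"
  shows "refl (U ** P ** ctranspose U) = U ** refl P ** ctranspose U"
proof -
  have "U ** (mat 1 - P) ** ctranspose U = mat 1 - U ** P ** ctranspose U"
    using assms by (simp only: matrix_mult_diff_left matrix_mult_diff_right matrix_mul_rid unitary_def)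
  then show ?thesis by (simp only: refl_def matrix_mult_diff_left[of "U ** P"] matrix_mult_diff_right[of U P])
qed

lemma inner_refl_self: "(refl P *v x) \<bullet> x = 2 * ((P *v x) \<bullet> x) - x \<bullet> x"
  by (simp only: refl_def mv_diff_left matrix_vector_mul_lid inner_diff_left)

lemma refl_inner_mat1:
  fixes P :: "'a::real_or_complex^'d^'d"
  assumes "P \<in> Proj n" "CARD('d) = 2 * n"
  shows "refl P \<bullet> mat 1 = 0"
proof -
  have "mat 1 \<bullet> (mat 1 :: 'a^'d^'d) = 2 * real n"
    using norm_mat1_squared[where 'a = 'a and 'n = 'd] assms(2) by (simp add: power2_norm_eq_inner)
  then show ?thesis using assms by (simp only: refl_def inner_diff_left Proj_iff)
qed

text \<open>
  Dominated convergence of the difference quotients at the points \<open>1 / (i + 1)\<close>.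
\<close>

lemma (in prob_space) derivative_of_vanishing_expectation:
  fixes f f' :: "real \<Rightarrow> 'a \<Rightarrow> real"
  assumes f [measurable]: "\<And>t. f t \<in> borel_measurable M"
    and f' [measurable]: "f' 0 \<in> borel_measurable M"
    and int: "\<And>t. integrable M (f t)"
    and zero: "\<And>t. (\<integral>\<omega>. f t \<omega> \<partial>M) = 0"
    and deriv: "\<And>\<omega> t. \<omega> \<in> space M \<Longrightarrow> ((\<lambda>t. f t \<omega>) has_real_derivative f' t \<omega>) (at t)"
    and bound: "\<And>\<omega> t. \<omega> \<in> space M \<Longrightarrow> \<bar>f' t \<omega>\<bar> \<le> B"
  shows "(\<integral>\<omega>. f' 0 \<omega> \<partial>M) = 0"
proof -
  define h where "h i = 1 / real (Suc i)" for i
  have h: "h i > 0" for i by (simp add: h_def)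
  have h0: "h \<longlonglongrightarrow> 0" unfolding h_def by (rule LIMSEQ_Suc[OF lim_1_over_n])
  have "(\<lambda>i. \<integral>\<omega>. (f (h i) \<omega> - f 0 \<omega>) / h i \<partial>M) \<longlonglongrightarrow> (\<integral>\<omega>. f' 0 \<omega> \<partial>M)"
  proof (rule integral_dominated_convergence[where w = "\<lambda>_. B"])
    show "AE \<omega> in M. (\<lambda>i. (f (h i) \<omega> - f 0 \<omega>) / h i) \<longlonglongrightarrow> f' 0 \<omega>"
    proof (rule AE_I2)
      fix \<omega> assume w: "\<omega> \<in> space M"
      have "((\<lambda>t. (f (0 + t) \<omega> - f 0 \<omega>) / t) \<longlongrightarrow> f' 0 \<omega>) (at 0)"
        using deriv[OF w, of 0] by (simp add: DERIV_def)
      moreover have "filterlim h (at 0) sequentially"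
        unfolding filterlim_at using h h0 by (auto simp: less_imp_neq[symmetric])
      ultimately show "(\<lambda>i. (f (h i) \<omega> - f 0 \<omega>) / h i) \<longlonglongrightarrow> f' 0 \<omega>"
        using filterlim_compose by fastforce
    qed
    show "AE \<omega> in M. norm ((f (h i) \<omega> - f 0 \<omega>) / h i) \<le> B" for i
    proof (rule AE_I2)
      fix \<omega> assume w: "\<omega> \<in> space M"
      obtain z where "f (h i) \<omega> - f 0 \<omega> = (h i - 0) * f' z \<omega>"
        using MVT2[OF h[of i], of "\<lambda>t. f t \<omega>" "\<lambda>t. f' t \<omega>"] deriv[OF w] by blast
      then show "norm ((f (h i) \<omega> - f 0 \<omega>) / h i) \<le> B"
        using bound[OF w, of z] h[of i] by simp
    qed
  qed measurable
  moreover have "(\<integral>\<omega>. (f (h i) \<omega> - f 0 \<omega>) / h i \<partial>M) = 0" for i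
    using int zero by simp
  ultimately have "(\<lambda>i::nat. 0) \<longlonglongrightarrow> (\<integral>\<omega>. f' 0 \<omega> \<partial>M)" by (simp only:)
  then show ?thesis by (simp add: LIMSEQ_const_iff)
qed

lemma has_derivative_mult_abs_power:
  "((\<lambda>z::real. z * \<bar>z\<bar> ^ k) has_real_derivative (real k + 1) * \<bar>z\<bar> ^ k) (at z)"
proof (cases "z = 0")
  case True
  show ?thesis
  proof (cases "k = 0")
    case False
    have "((\<lambda>h::real. \<bar>h\<bar> ^ k) \<longlongrightarrow> \<bar>0\<bar> ^ k) (at 0)" by (intro tendsto_intros)
    moreover have "\<forall>\<^sub>F h::real in at 0. \<bar>h\<bar> ^ k = (h * \<bar>h\<bar> ^ k - 0) / h"
      unfolding eventually_at_filter by (rule always_eventually) simp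
    ultimately have "((\<lambda>h::real. (h * \<bar>h\<bar> ^ k - 0) / h) \<longlongrightarrow> \<bar>0\<bar> ^ k) (at 0)"
      by (rule Lim_transform_eventually)
    then show ?thesis using False True by (simp add: DERIV_def power_0_left)
  qed auto
next
  case False
  have "(abs has_real_derivative sgn z) (at z)"
    using has_derivative_norm[of z] False
    by (simp add: has_field_derivative_def real_norm_def[abs_def] mult_commute_abs)
  then have "((\<lambda>z::real. z * \<bar>z\<bar> ^ k) has_real_derivative
      1 * \<bar>z\<bar> ^ k + (real k * \<bar>z\<bar> ^ (k - 1) * sgn z) * z) (at z)"
    using False by (auto intro!: derivative_eq_intros)
  also have "(real k * \<bar>z\<bar> ^ (k - 1) * sgn z) * z = real k * \<bar>z\<bar> ^ k"
    by (cases k) (simp_all add: abs_sgn[of z] mult_ac)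
  finally show ?thesis by (simp add: algebra_simps)
qed

locale uniform_projection = prob_space M for M :: "'w measure" +
  fixes n :: nat and P :: "'w \<Rightarrow> 'a::real_or_complex^'d^'d"
  assumes n: "n \<ge> 1" and card_d: "CARD('d) = 2 * n"
    and P: "P \<in> measurable M (proj_space n)"
    and unif: "uniform_proj_measure n (distr M (proj_space n) P)"
begin

lemma P_Proj: "\<omega> \<in> space M \<Longrightarrow> P \<omega> \<in> Proj n"
  using measurable_space[OF P] by (auto simp: proj_space_def space_restrict_space)

lemma P_hermitian_idempotent:
  assumes "\<omega> \<in> space M"
  shows "ctranspose (P \<omega>) = P \<omega>" "P \<omega> ** P \<omega> = P \<omega>"
  using P_Proj[OF assms] by (auto simp: Proj_iff)

lemma P_measurable [measurable]: "P \<in> borel_measurable M"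
  using P unfolding proj_space_def by (simp add: measurable_restrict_space2_iff)

abbreviation S :: "'w \<Rightarrow> 'a^'d^'d" where "S \<omega> \<equiv> refl (P \<omega>)"

lemma S_measurable [measurable]: "S \<in> borel_measurable M"
  unfolding refl_def by measurable

lemma inner_mv_measurable [measurable]: "(\<lambda>\<omega>. (S \<omega> *v x) \<bullet> y) \<in> borel_measurable M"
proof (rule borel_measurable_continuous_on[OF _ S_measurable])
  show "continuous_on UNIV (\<lambda>A::'a^'d^'d. (A *v x) \<bullet> y)"
    unfolding matrix_vector_mult_def by (intro continuous_intros)
qed

lemma S_bound:
  assumes "\<omega> \<in> space M" "norm x = 1" "norm y = 1"
  shows "\<bar>(S \<omega> *v x) \<bullet> y\<bar> \<le> 1"
  using Cauchy_Schwarz_ineq2[of "S \<omega> *v x" y] norm_refl_mv[OF P_hermitian_idempotent[OF assms(1)]] assms by simp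

lemma S_symmetric: "\<omega> \<in> space M \<Longrightarrow> (S \<omega> *v x) \<bullet> y = (S \<omega> *v y) \<bullet> x"
  by (metis inner_mv_left ctranspose_refl P_hermitian_idempotent(1) inner_commute)

text \<open>
  The reflection in \<open>y\<close> fixes \<open>x\<close> and negates \<open>y\<close>. So conjugating \<open>P\<close> with it changes the sign of
  the integrand, and preserves its mean.
\<close>

lemma odd_expectation_zero:
  assumes x: "norm x = 1" and y: "norm y = 1" and xy: "hip x y = 0"
    and g [measurable]: "g \<in> borel_measurable borel"
  shows "(\<integral>\<omega>. g ((S \<omega> *v x) \<bullet> x) * ((S \<omega> *v x) \<bullet> y) \<partial>M) = 0"
proof -
  define F where "F Q = g ((refl Q *v x) \<bullet> x) * ((refl Q *v x) \<bullet> y)" for Q :: "'a^'d^'d"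
  have 1: "(\<lambda>Q::'a^'d^'d. (refl Q *v x) \<bullet> v) \<in> borel_measurable borel" for v
    unfolding refl_def matrix_vector_mult_def
    by (intro borel_measurable_continuous_onI continuous_intros)
  have F: "F \<in> borel_measurable borel"
    unfolding F_def using 1 by measurable
  let ?U = "householder y"
  have U: "unitary ?U" using y by (rule unitary_householder)
  have Ux: "?U *v x = x" by (simp add: householder_mv xy)
  have Uy: "?U *v y = - y" by (simp add: householder_mv hip_self y vec_eq_iff)
  have neg: "F (?U ** P \<omega> ** ctranspose ?U) = - F (P \<omega>)" for \<omega>
  proof -
    have "((?U ** S \<omega> ** ctranspose ?U) *v x) \<bullet> v = (S \<omega> *v x) \<bullet> (?U *v v)" for v
      by (simp add: matrix_vector_mul_assoc[symmetric] Ux inner_mv_left[of ?U])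
    then show ?thesis
      unfolding F_def refl_conjugation[OF U] by (simp add: Ux Uy)
  qed
  have "(\<integral>\<omega>. F (?U ** P \<omega> ** ctranspose ?U) \<partial>M) = (\<integral>\<omega>. F (P \<omega>) \<partial>M)"
    by (rule uniform_proj_invariance[OF P unif U F])
  then show ?thesis unfolding neg by (simp add: F_def)
qed

text \<open>
  The orthonormal pair \<open>x, y\<close> of the preceding lemma can be rotated by any angle \<open>t\<close>; the
  derivative of the vanishing mean at \<open>t = 0\<close> is the claim. The test function is \<open>g(q) = q \<bar>q\<bar>\<^bsup>k\<^esup>\<close>,
  which is differentiable and leads to the absolute moments of \<open>q\<close>.
\<close>

lemma rotation_identity:
  assumes x: "norm x = 1" and y: "norm y = 1" and xy: "hip x y = 0"
  defines "q \<equiv> \<lambda>\<omega>. (S \<omega> *v x) \<bullet> x"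
  shows "(\<integral>\<omega>. 2 * (real k + 1) * \<bar>q \<omega>\<bar> ^ k * ((S \<omega> *v x) \<bullet> y)\<^sup>2
    + q \<omega> * \<bar>q \<omega>\<bar> ^ k * ((S \<omega> *v y) \<bullet> y - q \<omega>) \<partial>M) = 0"
proof -
  define r where "r \<omega> = (S \<omega> *v x) \<bullet> y" for \<omega>
  define p where "p \<omega> = (S \<omega> *v y) \<bullet> y" for \<omega>
  define xt where "xt t = cos t *\<^sub>R x + sin t *\<^sub>R y" for t
  define yt where "yt t = (- sin t) *\<^sub>R x + cos t *\<^sub>R y" for t
  have yx: "hip y x = 0" using xy by (metis conjugate_hip conjugate_0)
  have xt: "norm (xt t) = 1" and yt: "norm (yt t) = 1" and xyt: "hip (xt t) (yt t) = 0" for t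
  proof -
    have "x \<bullet> y = 0" using xy by (metis real_part_hip real_part_0)
    moreover have "x \<bullet> x = 1" "y \<bullet> y = 1" using x y by (simp_all add: dot_square_norm)
    ultimately have "xt t \<bullet> xt t = 1" "yt t \<bullet> yt t = 1"
      using sin_cos_squared_add[of t]
      by (simp_all add: xt_def yt_def inner_simps inner_commute power2_eq_square)
    then show "norm (xt t) = 1" "norm (yt t) = 1" by (simp_all add: norm_eq_sqrt_inner)
    show "hip (xt t) (yt t) = 0"
      by (simp add: xt_def yt_def xy yx hip_self x y mult.commute)
  qed
  define a where "a t \<omega> = (S \<omega> *v xt t) \<bullet> xt t" for t \<omega>
  define b where "b t \<omega> = (S \<omega> *v xt t) \<bullet> yt t" for t \<omega>
  define b' where "b' t \<omega> = (S \<omega> *v yt t) \<bullet> yt t - a t \<omega>" for t \<omega>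
  define g where "g z = z * \<bar>z\<bar> ^ k" for z :: real
  define f where "f t \<omega> = g (a t \<omega>) * b t \<omega>" for t \<omega>
  define f' where "f' t \<omega> = ((real k + 1) * \<bar>a t \<omega>\<bar> ^ k * (2 * b t \<omega>)) * b t \<omega> + b' t \<omega> * g (a t \<omega>)" for t \<omega>
  have [measurable]: "g \<in> borel_measurable borel" unfolding g_def by measurable
  have [measurable]: "f t \<in> borel_measurable M" for t
    unfolding f_def a_def b_def by measurable
  have [measurable]: "f' t \<in> borel_measurable M" for t
    unfolding f'_def a_def b_def b'_def by measurable
  have bnd: "\<bar>a t \<omega>\<bar> \<le> 1" "\<bar>b t \<omega>\<bar> \<le> 1" "\<bar>b' t \<omega>\<bar> \<le> 2" "\<bar>g (a t \<omega>)\<bar> \<le> 1" "\<bar>a t \<omega>\<bar> ^ k \<le> 1"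
    if w: "\<omega> \<in> space M" for t \<omega>
  proof -
    show 1: "\<bar>a t \<omega>\<bar> \<le> 1" "\<bar>b t \<omega>\<bar> \<le> 1"
      unfolding a_def b_def by (intro S_bound w xt yt)+
    have "\<bar>(S \<omega> *v yt t) \<bullet> yt t\<bar> \<le> 1" by (intro S_bound w yt)
    then show "\<bar>b' t \<omega>\<bar> \<le> 2" using 1 unfolding b'_def by linarith
    show 2: "\<bar>a t \<omega>\<bar> ^ k \<le> 1" using 1 by (intro power_le_one) auto
    show "\<bar>g (a t \<omega>)\<bar> \<le> 1" unfolding g_def abs_mult using 1 2 by (intro mult_le_one) auto
  qed
  have "(\<integral>\<omega>. f' 0 \<omega> \<partial>M) = 0"
  proof (rule derivative_of_vanishing_expectation[where f = f])
    show "integrable M (f t)" for t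
    proof (rule integrable_bounded[where K = 1])
      show "norm (f t \<omega>) \<le> 1" if "\<omega> \<in> space M" for \<omega>
        unfolding f_def real_norm_def abs_mult using bnd[OF that] by (intro mult_le_one) auto
    qed measurable
    show "(\<integral>\<omega>. f t \<omega> \<partial>M) = 0" for t
      unfolding f_def a_def b_def by (intro odd_expectation_zero xt yt xyt) simp
    fix \<omega> t assume w: "\<omega> \<in> space M"
    show "\<bar>f' t \<omega>\<bar> \<le> 2 * (real k + 1) + 2"
    proof -
      have f'_eq: "f' t \<omega> = 2 * (real k + 1) * (\<bar>a t \<omega>\<bar> ^ k * (b t \<omega>)\<^sup>2) + b' t \<omega> * g (a t \<omega>)"
        by (simp add: f'_def power2_eq_square algebra_simps)
      have "\<bar>f' t \<omega>\<bar> \<le> \<bar>2 * (real k + 1) * (\<bar>a t \<omega>\<bar> ^ k * (b t \<omega>)\<^sup>2)\<bar> + \<bar>b' t \<omega> * g (a t \<omega>)\<bar>"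
        unfolding f'_eq by (rule abs_triangle_ineq)
      also have "\<dots> = 2 * (real k + 1) * (\<bar>a t \<omega>\<bar> ^ k * (b t \<omega>)\<^sup>2) + \<bar>b' t \<omega>\<bar> * \<bar>g (a t \<omega>)\<bar>"
        by (subst abs_of_nonneg) (auto simp: abs_mult)
      also have "\<dots> \<le> 2 * (real k + 1) * (1 * 1) + 2 * 1"
        using bnd[OF w] by (intro add_mono mult_mono) (auto simp: abs_square_le_1)
      finally show ?thesis by simp
    qed
    have a: "a t \<omega> = (cos t)\<^sup>2 * q \<omega> + 2 * cos t * sin t * r \<omega> + (sin t)\<^sup>2 * p \<omega>" for t
      unfolding a_def xt_def q_def r_def p_def
      by (simp add: mv_add_right mv_scaleR_right inner_simps power2_eq_square algebra_simps
          S_symmetric[OF w, of y x])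
    have b: "b t \<omega> = cos t * sin t * (p \<omega> - q \<omega>) + ((cos t)\<^sup>2 - (sin t)\<^sup>2) * r \<omega>" for t
      unfolding b_def xt_def yt_def q_def r_def p_def
      by (simp add: mv_add_right mv_scaleR_right inner_simps power2_eq_square algebra_simps
          S_symmetric[OF w, of y x])
    have b': "b' t \<omega> = ((cos t)\<^sup>2 - (sin t)\<^sup>2) * (p \<omega> - q \<omega>) - 4 * cos t * sin t * r \<omega>" for t
      unfolding b'_def a yt_def q_def r_def p_def
      by (simp add: mv_add_right mv_scaleR_right mv_diff_right inner_simps power2_eq_square algebra_simps
          S_symmetric[OF w, of y x])
    have da: "((\<lambda>t. a t \<omega>) has_real_derivative 2 * b t \<omega>) (at t)"
      unfolding a b by (auto intro!: derivative_eq_intros simp: power2_eq_square algebra_simps)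
    have db: "((\<lambda>t. b t \<omega>) has_real_derivative b' t \<omega>) (at t)"
      unfolding b b' by (auto intro!: derivative_eq_intros simp: power2_eq_square algebra_simps)
    have dg: "((\<lambda>t. g (a t \<omega>)) has_real_derivative (real k + 1) * \<bar>a t \<omega>\<bar> ^ k * (2 * b t \<omega>)) (at t)"
      unfolding g_def by (rule DERIV_chain2[OF has_derivative_mult_abs_power da])
    show "((\<lambda>t. f t \<omega>) has_real_derivative f' t \<omega>) (at t)"
      unfolding f_def f'_def by (rule DERIV_mult[OF dg db])
  qed measurable
  moreover have "f' 0 \<omega> = 2 * (real k + 1) * \<bar>q \<omega>\<bar> ^ k * ((S \<omega> *v x) \<bullet> y)\<^sup>2
    + q \<omega> * \<bar>q \<omega>\<bar> ^ k * ((S \<omega> *v y) \<bullet> y - q \<omega>)" for \<omega>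
    by (simp add: f'_def a_def b_def b'_def g_def xt_def yt_def q_def power2_eq_square mult_ac)
  ultimately show ?thesis by simp
qed

text \<open>
  Sum the rotation identity over an orthonormal basis of the complement of \<open>x\<close>. The squares add up
  to \<open>1 - q\<^sup>2\<close>, since \<open>S x\<close> is a unit vector, and the diagonal entries to a multiple of \<open>q\<close>, since \<open>S\<close> has
  trace 0. In terms of \<open>g\<close>, this is \<open>E g'(q) (1 - q\<^sup>2) = K E g(q) q\<close> with \<open>K = DIM('a) n\<close>, the Stein equation
  of the symmetric Beta distribution with parameter \<open>K / 2 = \<beta> n\<close>, moved to the interval from \<open>- 1\<close> to 1.
\<close>

lemma moment_recursion:
  assumes x: "norm x = 1"
  defines "q \<equiv> \<lambda>\<omega>. (S \<omega> *v x) \<bullet> x"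
  shows "(real k + 1 + real (DIM('a) * n)) * (\<integral>\<omega>. \<bar>q \<omega>\<bar> ^ (k + 2) \<partial>M) = (real k + 1) * (\<integral>\<omega>. \<bar>q \<omega>\<bar> ^ k \<partial>M)"
proof -
  obtain C where C: "finite C" "\<And>y. y \<in> C \<Longrightarrow> norm y = 1 \<and> hip y x = 0" "pairwise orthogonal C"
    "\<And>v. (\<Sum>y\<in>C. (v \<bullet> y) *\<^sub>R y) = v - hip v x *s x"
    by (rule orthonormal_complement_basis[OF x]) blast
  have mat1: "mat 1 \<bullet> (mat 1 :: 'a^'d^'d) = 2 * real n"
    using norm_mat1_squared[where 'a = 'a and 'n = 'd] card_d by (simp add: power2_norm_eq_inner)
  have xx: "x \<bullet> x = 1" using x by (simp add: dot_square_norm)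
  have "real (card C) = (\<Sum>y\<in>C. (mat 1 *v y) \<bullet> y)" using C(2) by (simp add: dot_square_norm)
  then have card_C: "real (card C) = DIM('a) * (2 * real n - 1)"
    unfolding sum_complement_basis(1)[OF C(1,4)] by (simp add: mat1 xx)
  define h where "h y \<omega> = 2 * (real k + 1) * \<bar>q \<omega>\<bar> ^ k * ((S \<omega> *v x) \<bullet> y)\<^sup>2
    + q \<omega> * \<bar>q \<omega>\<bar> ^ k * ((S \<omega> *v y) \<bullet> y - q \<omega>)" for y \<omega>
  have q_bound: "\<bar>q \<omega>\<bar> \<le> 1" if "\<omega> \<in> space M" for \<omega>
    unfolding q_def by (intro S_bound x that)
  have [measurable]: "q \<in> borel_measurable M" unfolding q_def by measurable
  have int_q: "integrable M (\<lambda>\<omega>. \<bar>q \<omega>\<bar> ^ j)" for j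
    by (rule integrable_bounded[where K = 1]) (use q_bound in \<open>auto intro: power_le_one\<close>)
  have sum_h: "(\<Sum>y\<in>C. h y \<omega>) = 2 * ((real k + 1) * \<bar>q \<omega>\<bar> ^ k - (real k + 1 + real (DIM('a) * n)) * \<bar>q \<omega>\<bar> ^ (k + 2))"
    if w: "\<omega> \<in> space M" for \<omega>
  proof -
    have herm: "ctranspose (S \<omega>) = S \<omega>" by (intro ctranspose_refl P_hermitian_idempotent w)
    have "(\<Sum>y\<in>C. ((S \<omega> *v x) \<bullet> y)\<^sup>2) = 1 - (q \<omega>)\<^sup>2"
      unfolding sum_complement_basis(2)[OF C(1,4)] hip_hermitian[OF herm]
      using x by (simp add: dot_square_norm norm_refl_mv[OF P_hermitian_idempotent[OF w]] q_def)
    moreover have "(\<Sum>y\<in>C. (S \<omega> *v y) \<bullet> y) = - (DIM('a) * q \<omega>)"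
      unfolding sum_complement_basis(1)[OF C(1,4)] refl_inner_mat1[OF P_Proj[OF w] card_d]
      by (simp add: q_def)
    ultimately have "(\<Sum>y\<in>C. h y \<omega>) = 2 * (real k + 1) * \<bar>q \<omega>\<bar> ^ k * (1 - (q \<omega>)\<^sup>2)
        + q \<omega> * \<bar>q \<omega>\<bar> ^ k * (- (DIM('a) * q \<omega>) - DIM('a) * (2 * real n - 1) * q \<omega>)"
      unfolding h_def sum.distrib sum_distrib_left[symmetric] sum_subtractf
      by (simp add: card_C)
    also have "\<dots> = 2 * (real k + 1) * \<bar>q \<omega>\<bar> ^ k * (1 - (q \<omega>)\<^sup>2)
        - 2 * real (DIM('a) * n) * (\<bar>q \<omega>\<bar> ^ k * (q \<omega>)\<^sup>2)"
      by (simp add: power2_eq_square algebra_simps)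
    also have "(q \<omega>)\<^sup>2 = \<bar>q \<omega>\<bar>\<^sup>2" by simp
    finally show ?thesis by (simp only: power_add) (simp add: algebra_simps)
  qed
  have int_h: "integrable M (h y)" if y: "y \<in> C" for y
  proof (rule integrable_bounded)
    have y1: "norm y = 1" using C(2) y by blast
    show "norm (h y \<omega>) \<le> 2 * (real k + 1) + 2" if w: "\<omega> \<in> space M" for \<omega>
    proof -
      have qk: "\<bar>q \<omega>\<bar> ^ k \<le> 1" using q_bound[OF w] by (intro power_le_one) auto
      have "\<bar>(S \<omega> *v x) \<bullet> y\<bar> ^ 2 \<le> 1" using S_bound[OF w x y1] by (intro power_le_one) auto
      then have s: "((S \<omega> *v x) \<bullet> y)\<^sup>2 \<le> 1" by simp
      have p: "\<bar>(S \<omega> *v y) \<bullet> y - q \<omega>\<bar> \<le> 2" using S_bound[OF w y1 y1] q_bound[OF w] by linarith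
      have "norm (h y \<omega>) \<le> 2 * (real k + 1) * (\<bar>q \<omega>\<bar> ^ k * ((S \<omega> *v x) \<bullet> y)\<^sup>2)
          + (\<bar>q \<omega>\<bar> * \<bar>q \<omega>\<bar> ^ k) * \<bar>(S \<omega> *v y) \<bullet> y - q \<omega>\<bar>"
        unfolding h_def real_norm_def
        by (rule order_trans[OF abs_triangle_ineq]) (simp add: abs_mult mult_ac)
      also have "\<dots> \<le> 2 * (real k + 1) * (1 * 1) + (1 * 1) * 2"
        using qk s p q_bound[OF w] by (intro add_mono mult_mono) auto
      finally show ?thesis by simp
    qed
    show "h y \<in> borel_measurable M" unfolding h_def by measurable
  qed
  have "(\<integral>\<omega>. h y \<omega> \<partial>M) = 0" if "y \<in> C" for y
    unfolding h_def q_def using C(2)[OF that] x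
    by (intro rotation_identity) (auto simp: conjugate_hip[of y x, symmetric])
  then have "0 = (\<integral>\<omega>. (\<Sum>y\<in>C. h y \<omega>) \<partial>M)"
    using int_h by (simp add: Bochner_Integration.integral_sum)
  also have "\<dots> = (\<integral>\<omega>. 2 * ((real k + 1) * \<bar>q \<omega>\<bar> ^ k - (real k + 1 + real (DIM('a) * n)) * \<bar>q \<omega>\<bar> ^ (k + 2)) \<partial>M)"
    using sum_h by (intro Bochner_Integration.integral_cong) auto
  also have "\<dots> = 2 * ((real k + 1) * (\<integral>\<omega>. \<bar>q \<omega>\<bar> ^ k \<partial>M) - (real k + 1 + real (DIM('a) * n)) * (\<integral>\<omega>. \<bar>q \<omega>\<bar> ^ (k + 2) \<partial>M))"
    using int_q[of k] int_q[of "k + 2"] by simp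
  finally show ?thesis by simp
qed

end

lemma Gamma_duplication_real:
  fixes a :: real
  assumes "a > 0"
  shows "Gamma a * Gamma (a + 1 / 2) = 2 / 4 powr a * sqrt pi * Gamma (2 * a)"
proof -
  have n: "complex_of_real z \<notin> \<int>\<^sub>\<le>\<^sub>0" if "z > 0" for z
    using that by (auto elim!: nonpos_Ints_cases simp: complex_eq_iff)
  have e: "exp ((1 - 2 * a) * ln 2) = 2 / 4 powr a"
  proof -
    have "ln (4::real) = 2 * ln 2" using ln_realpow[of "2::real" 2] by simp
    then have "(1 - 2 * a) * ln 2 = ln 2 - a * ln 4" by (simp add: algebra_simps)
    then show ?thesis by (simp add: powr_def exp_diff)
  qed
  have "complex_of_real (Gamma a * Gamma (a + 1 / 2)) = Gamma (of_real a) * Gamma (of_real a + 1 / 2)"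
    using Gamma_complex_of_real[of "a + 1 / 2"] by (simp add: Gamma_complex_of_real)
  also have "\<dots> = exp ((1 - 2 * of_real a) * of_real (ln 2)) * of_real (sqrt pi) * Gamma (2 * of_real a)"
    using n[of a] n[of "a + 1 / 2"] assms by (intro Gamma_legendre_duplication) auto
  also have "\<dots> = of_real (exp ((1 - 2 * a) * ln 2) * sqrt pi * Gamma (2 * a))"
    using Gamma_complex_of_real[of "2 * a"] exp_of_real[of "(1 - 2 * a) * ln 2", where 'a = complex]
    by simp
  finally show ?thesis unfolding e of_real_eq_iff .
qed

text \<open>
  The recursion determines the even moments and expresses the odd ones through the first. So
  \<open>m (2j + 2) \<le> m (2j + 1)\<close> becomes a lower bound for \<open>m 1\<close> by a quotient of Pochhammer symbols. By
  Euler's limit formula for the Gamma function, where all powers of \<open>j\<close> cancel, it tends to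
  \<open>\<Gamma>(a + 1/2) / (\<Gamma>(1/2) a \<Gamma>(a))\<close>, and Legendre's duplication formula turns this into the Beta function.
  The bound is sharp in the limit, as consecutive moments are asymptotically equal.
\<close>

lemma first_moment_lower_bound:
  fixes m :: "nat \<Rightarrow> real"
  assumes a: "a > 0" and m0: "m 0 = 1"
    and rec: "\<And>k. (real k + 1 + 2 * a) * m (k + 2) = (real k + 1) * m k"
    and decr: "\<And>k. m (Suc k) \<le> m k"
  shows "m 1 \<ge> 2 / (a * 4 powr a * Beta a a)"
proof -
  have pos: "pochhammer z j > 0" if "z > 0" for z :: real and j
    using that by (rule pochhammer_pos)
  have even: "m (2 * j) * pochhammer (1 / 2 + a) j = pochhammer (1 / 2) j" for j
  proof (induction j)
    case (Suc j)
    have "m (2 * Suc j) * (1 / 2 + a + real j) = m (2 * j) * (1 / 2 + real j)"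
      using rec[of "2 * j"] by (simp add: algebra_simps)
    then have "m (2 * Suc j) * pochhammer (1 / 2 + a) (Suc j) =
        m (2 * j) * (1 / 2 + real j) * pochhammer (1 / 2 + a) j"
      by (simp add: pochhammer_Suc mult_ac)
    also have "\<dots> = pochhammer (1 / 2) (Suc j)"
      using Suc by (simp add: pochhammer_Suc mult_ac)
    finally show ?case .
  qed (simp add: m0)
  have odd: "m (2 * j + 1) * pochhammer (a + 1) j = m 1 * fact j" for j
  proof (induction j)
    case (Suc j)
    have "m (2 * Suc j + 1) * (a + 1 + real j) = m (2 * j + 1) * (real j + 1)"
      using rec[of "2 * j + 1"] by (simp add: algebra_simps)
    then have "m (2 * Suc j + 1) * pochhammer (a + 1) (Suc j) =
        m (2 * j + 1) * (real j + 1) * pochhammer (a + 1) j"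
      by (simp add: pochhammer_Suc mult_ac)
    also have "\<dots> = m 1 * fact (Suc j)"
      using Suc by (simp add: mult_ac)
    finally show ?case .
  qed simp
  define R where "R j = Gamma_series (a + 1 / 2) j / (Gamma_series (1 / 2) j * (a * Gamma_series a j))" for j
  have "R j \<le> m 1" for j
  proof -
    have "R j = pochhammer (1 / 2) (j + 1) * pochhammer a (j + 1) /
        (pochhammer (1 / 2 + a) (j + 1) * (a * fact j))"
    proof -
      have e: "exp ((a + 1 / 2) * ln (real j)) = exp (1 / 2 * ln (real j)) * exp (a * ln (real j))"
        by (simp add: exp_add[symmetric] algebra_simps)
      have arith: "(f * (u * v) / p3) / ((f * u / p1) * (a * (f * v / p2))) = p1 * p2 / (p3 * (a * f))"
        if "u \<noteq> 0" "v \<noteq> 0" "f \<noteq> 0" for f u v p1 p2 p3 :: real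
        using that by (simp add: field_simps)
      show ?thesis unfolding R_def Gamma_series_def of_real_eq_id id_apply e
        using arith[of "exp (1 / 2 * ln (real j))" "exp (a * ln (real j))" "fact j"
            "pochhammer (a + 1 / 2) (j + 1)" "pochhammer (1 / 2) (j + 1)" "pochhammer a (j + 1)"]
        by (simp add: add.commute[of a])
    qed
    also have "\<dots> = m (2 * j + 2) * (pochhammer (a + 1) j / fact j)"
      using even[of "j + 1"] a pos[of "1 / 2 + a" "j + 1"]
      by (simp add: pochhammer_rec[of a] divide_simps mult_ac)
    also have "\<dots> \<le> m (2 * j + 1) * (pochhammer (a + 1) j / fact j)"
      using decr[of "2 * j + 1"] pos[of "a + 1" j] a by (intro mult_right_mono) auto
    also have "\<dots> = m 1" using odd[of j] by simp
    finally show ?thesis .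
  qed
  moreover have "Gamma a \<noteq> 0" using Gamma_real_pos[OF a] by linarith
  then have "R \<longlonglongrightarrow> Gamma (a + 1 / 2) / (Gamma (1 / 2) * (a * Gamma a))"
    unfolding R_def using a
    by (intro tendsto_intros) (auto simp: Gamma_one_half_real)
  ultimately have "Gamma (a + 1 / 2) / (Gamma (1 / 2) * (a * Gamma a)) \<le> m 1"
    by (intro LIMSEQ_le_const2) auto
  moreover have "Gamma (a + 1 / 2) / (Gamma (1 / 2) * (a * Gamma a)) = 2 / (a * 4 powr a * Beta a a)"
  proof -
    have G: "Gamma a > 0" "Gamma (2 * a) > 0" using a by (auto intro: Gamma_real_pos)
    have "Gamma (a + 1 / 2) = 2 / 4 powr a * sqrt pi * Gamma (2 * a) / Gamma a"
      using Gamma_duplication_real[OF a] G by (simp add: field_simps)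
    moreover have "2 / w * p * h / g / (p * (a * g)) = 2 / (a * w * (g * g / h))"
      if "p > 0" "h > 0" "g > 0" for p h g w :: real
      using that by (simp add: field_simps)
    ultimately show ?thesis using G unfolding Gamma_one_half_real Beta_def mult_2[symmetric] by simp
  qed
  ultimately show ?thesis by simp
qed

section \<open>The mean of the observed reflections\<close>

text \<open>
  The reflection \<open>2 R - 1\<close>, where \<open>R\<close> is the projection selected by the answer for \<open>P\<close>. In terms of it,
  the answer is the sign that makes the quadratic form of \<open>2 P - 1\<close> nonnegative at \<open>x\<close>.
\<close>

definition observed :: "'a::real_or_complex^'d^'d \<Rightarrow> 'a^'d^'d \<Rightarrow> 'a^'d^'d" where
  "observed X P = refl (if phi P X = 1 then P else mat 1 - P)"

lemma phi_outer_eq_1_iff: "phi P (outer x) = 1 \<longleftrightarrow> (P *v x) \<bullet> x \<ge> 1 / 2"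
  by (simp add: phi_def real_part_trace_mult inner_outer)

lemma complement_projection:
  assumes "ctranspose P = P" "P ** P = P"
  shows "ctranspose (mat 1 - P) = mat 1 - P" "(mat 1 - P) ** (mat 1 - P) = mat 1 - P"
  using assms by (simp_all add: matrix_mult_linear)

lemma refl_complement: "refl (mat 1 - P) = - refl P"
  by (simp add: refl_def)

lemma observed_alt: "observed X P = (if phi P X = 1 then refl P else - refl P)"
  by (simp add: observed_def refl_complement)

lemma inner_observed_self:
  fixes x :: "'a::real_or_complex^'d"
  assumes "norm x = 1"
  shows "(observed (outer x) P *v x) \<bullet> x = \<bar>(refl P *v x) \<bullet> x\<bar>"
proof -
  have "(- A *v x) \<bullet> x = - ((A *v x) \<bullet> x)" for A :: "'a^'d^'d"
    using mv_scaleR_left[of "-1" A x] by simp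
  then show ?thesis using assms unfolding observed_alt phi_outer_eq_1_iff
    by (auto simp: inner_refl_self dot_square_norm abs_if)
qed

lemma observed_measurable [measurable]:
  fixes x :: "'a::real_or_complex^'d"
  shows "observed (outer x) \<in> borel_measurable borel"
proof -
  have [measurable]: "refl \<in> borel_measurable (borel :: ('a^'d^'d) measure)"
    unfolding refl_def by (intro borel_measurable_continuous_onI continuous_intros)
  have [measurable]: "(\<lambda>P. (P *v x) \<bullet> x) \<in> borel_measurable borel"
    unfolding matrix_vector_mult_def by (intro borel_measurable_continuous_onI continuous_intros)
  show ?thesis unfolding observed_alt phi_outer_eq_1_iff by measurable
qed

text \<open>
  The answer depends on \<open>P\<close> only through \<open>\<langle>P x, x\<rangle>\<close>, so it is unchanged if \<open>P\<close> is conjugated by a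
  reflection that preserves the line of \<open>x\<close>.
\<close>

lemma observed_conjugation:
  assumes w: "norm w = 1" and x: "householder w *v x = x \<or> householder w *v x = - x"
  shows "observed (outer x) (householder w ** P ** householder w) =
    householder w ** observed (outer x) P ** householder w"
proof -
  let ?H = "householder w"
  have "((?H ** P ** ?H) *v x) \<bullet> x = (P *v (?H *v x)) \<bullet> (?H *v x)"
    by (simp add: matrix_vector_mul_assoc[symmetric] inner_mv_left[of ?H])
  also have "\<dots> = (P *v x) \<bullet> x"
    using x mv_scaleR_right[of P "-1" x] by auto
  finally have p: "phi (?H ** P ** ?H) (outer x) = 1 \<longleftrightarrow> phi P (outer x) = 1" by (simp only: phi_outer_eq_1_iff)
  have "refl (?H ** P ** ?H) = ?H ** refl P ** ?H"
    using refl_conjugation[OF unitary_householder[OF w], of P] by simp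
  moreover have "?H ** - refl P ** ?H = - (?H ** refl P ** ?H)"
    using matrix_mult_scaleR_left[of "-1" "?H ** refl P" ?H] matrix_mult_scaleR_right[of ?H "-1" "refl P"]
    by simp
  ultimately show ?thesis by (simp only: observed_alt p split: if_split) simp
qed

lemma observed_reflection:
  fixes P :: "'a::real_or_complex^'d^'d"
  assumes "ctranspose P = P" "P ** P = P"
  shows "ctranspose (observed X P) = observed X P" "norm (observed X P *v v) = norm v"
    "norm (observed X P) = norm (mat 1 :: 'a^'d^'d)"
proof -
  define Q where "Q = (if phi P X = 1 then P else mat 1 - P)"
  have Q: "ctranspose Q = Q" "Q ** Q = Q"
    using assms complement_projection[OF assms] by (auto simp: Q_def)
  have o: "observed X P = refl Q" by (simp add: observed_def Q_def)
  show "ctranspose (observed X P) = observed X P" unfolding o by (rule ctranspose_refl[OF Q(1)])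
  show "norm (observed X P *v v) = norm v" unfolding o by (rule norm_refl_mv[OF Q])
  have "refl Q \<bullet> refl Q = mat 1 \<bullet> (refl Q ** refl Q)"
    using inner_matrix_mult_left[of "refl Q" "mat 1" "refl Q"] by (simp add: ctranspose_refl[OF Q(1)])
  then show "norm (observed X P) = norm (mat 1 :: 'a^'d^'d)"
    unfolding o by (simp add: refl_square[OF Q(2)] norm_eq_sqrt_inner)
qed

context uniform_projection
begin

lemma first_moment:
  assumes x: "norm x = 1"
  shows "(\<integral>\<omega>. \<bar>(S \<omega> *v x) \<bullet> x\<bar> \<partial>M) \<ge> 2 * (mu1 (beta_param TYPE('a)) n - 1 / 2)"
proof -
  define a where "a = beta_param TYPE('a) * real n"
  have a: "a > 0" using n by (simp add: a_def beta_param_def)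
  have a2: "real (DIM('a) * n) = 2 * a" by (simp add: a_def beta_param_def)
  define m where "m k = (\<integral>\<omega>. \<bar>(S \<omega> *v x) \<bullet> x\<bar> ^ k \<partial>M)" for k
  have q: "\<bar>(S \<omega> *v x) \<bullet> x\<bar> \<le> 1" if "\<omega> \<in> space M" for \<omega>
    by (intro S_bound x that)
  have int: "integrable M (\<lambda>\<omega>. \<bar>(S \<omega> *v x) \<bullet> x\<bar> ^ k)" for k
  proof (rule integrable_bounded[where K = 1])
    show "norm (\<bar>(S \<omega> *v x) \<bullet> x\<bar> ^ k) \<le> 1" if "\<omega> \<in> space M" for \<omega>
      using q[OF that] by (simp add: power_le_one)
  qed measurable
  have "m 1 \<ge> 2 / (a * 4 powr a * Beta a a)"
  proof (rule first_moment_lower_bound[OF a])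
    show "m 0 = 1" by (simp add: m_def prob_space)
    show "(real k + 1 + 2 * a) * m (k + 2) = (real k + 1) * m k" for k
      using moment_recursion[OF x, of k] unfolding m_def a2 .
    show "m (Suc k) \<le> m k" for k
      unfolding m_def by (intro integral_mono int power_decreasing) (use q in auto)
  qed
  then show ?thesis by (simp add: mu1_def m_def a_def mult.assoc)
qed

text \<open>
  The mean \<open>B\<close> commutes with the reflection in \<open>w\<close> if \<open>w\<close> is \<open>x\<close> or orthogonal to \<open>x\<close>, so each such \<open>w\<close> is an
  eigenvector of \<open>B\<close>. When all vectors of a subspace are eigenvectors, there is only one eigenvalue;
  so \<open>B\<close> acts as a scalar \<open>g\<close> on the complement of \<open>x\<close>. The eigenvalue at \<open>x\<close> is the first absolute moment
  of \<open>q\<close>, and \<open>g\<close> follows from it because \<open>B\<close> has trace 0.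
\<close>

lemma mean_observed:
  assumes x: "norm x = 1"
  obtains g d where "(\<integral>\<omega>. observed (outer x) (P \<omega>) \<partial>M) = g *\<^sub>R mat 1 + d *\<^sub>R outer x"
    "d \<ge> 2 * (mu1 (beta_param TYPE('a)) n - mu2 (beta_param TYPE('a)) n)"
proof -
  define T where "T \<omega> = observed (outer x) (P \<omega>)" for \<omega>
  have [measurable]: "T \<in> borel_measurable M" unfolding T_def by measurable
  have int: "integrable M T"
    by (rule integrable_bounded[where K = "norm (mat 1 :: 'a^'d^'d)"])
      (auto simp: T_def observed_reflection P_hermitian_idempotent)
  define B where "B = (\<integral>\<omega>. T \<omega> \<partial>M)"
  have lin: "L B = (\<integral>\<omega>. L (T \<omega>) \<partial>M)" if "linear L" for L :: "'a^'d^'d \<Rightarrow> 'a^'d^'d"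
    unfolding B_def using that int
    by (intro integral_bounded_linear[symmetric]) (simp_all add: linear_conv_bounded_linear)
  have "linear (ctranspose :: 'a^'d^'d \<Rightarrow> 'a^'d^'d)" by (rule linearI) simp_all
  then have "ctranspose B = (\<integral>\<omega>. ctranspose (T \<omega>) \<partial>M)" by (rule lin)
  also have "\<dots> = B" unfolding B_def
    by (rule Bochner_Integration.integral_cong) (simp_all add: T_def observed_reflection P_hermitian_idempotent)
  finally have herm: "ctranspose B = B" .
  have inner_B: "B \<bullet> A = (\<integral>\<omega>. T \<omega> \<bullet> A \<partial>M)" for A
    unfolding B_def using int by (rule integral_inner_left[symmetric])
  have eigen: "B *v w = ((B *v w) \<bullet> w) *\<^sub>R w"
    if w: "norm w = 1" "w = x \<or> hip w x = 0" for w
  proof -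
    let ?H = "householder w"
    have "?H *v x = x \<or> ?H *v x = - x"
      using w(2)
    proof
      assume "w = x"
      moreover have "?H *v w = - w" using w(1) by (simp add: householder_mv hip_self vec_eq_iff)
      ultimately show ?thesis by simp
    next
      assume "hip w x = 0"
      then have "hip x w = 0" by (metis conjugate_hip conjugate_0)
      then show ?thesis by (simp add: householder_mv)
    qed
    note conj = observed_conjugation[OF w(1) this]
    have "linear (\<lambda>A. ?H ** A ** ?H)"
      by (rule linearI) (simp_all add: matrix_mult_linear)
    then have "?H ** B ** ?H = (\<integral>\<omega>. ?H ** T \<omega> ** ?H \<partial>M)" by (rule lin)
    also have "\<dots> = (\<integral>\<omega>. observed (outer x) (?H ** P \<omega> ** ctranspose ?H) \<partial>M)"
      by (simp add: T_def conj)
    also have "\<dots> = B" unfolding B_def T_def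
      by (rule uniform_proj_invariance[OF P unif unitary_householder[OF w(1)] observed_measurable])
    finally have HBH: "?H ** B ** ?H = B" .
    have Hw: "?H *v w = - w" using w(1) by (simp add: householder_mv hip_self vec_eq_iff)
    have Hinv: "?H *v (?H *v v) = v" for v
      by (simp add: matrix_vector_mul_assoc householder_square w(1))
    have "?H *v (B *v w) = ?H *v (?H *v (B *v (?H *v w)))"
      using HBH by (metis matrix_vector_mul_assoc)
    also have "\<dots> = - (B *v w)" using mv_scaleR_right[of B "-1" w] by (simp add: Hinv Hw)
    finally have "B *v w - (2 * hip (B *v w) w) *s w = - (B *v w)" by (simp add: householder_mv)
    then have "2 *\<^sub>R (B *v w) = 2 *\<^sub>R (hip (B *v w) w *s w)"
      by (simp add: vec_eq_iff scaleR_conv_of_real algebra_simps)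
    then have "B *v w = hip (B *v w) w *s w" by (simp only: scaleR_cancel_left) simp
    then show ?thesis unfolding hip_hermitian[OF herm] scale_of_real .
  qed
  obtain C where C: "finite C" "\<And>y. y \<in> C \<Longrightarrow> norm y = 1 \<and> hip y x = 0" "pairwise orthogonal C"
    "\<And>v. (\<Sum>y\<in>C. (v \<bullet> y) *\<^sub>R y) = v - hip v x *s x"
    by (rule orthonormal_complement_basis[OF x]) blast
  have same: "(B *v y) \<bullet> y = (B *v z) \<bullet> z" if y: "y \<in> C" and z: "z \<in> C" for y z
  proof (cases "y = z")
    case False
    then have yz: "y \<bullet> z = 0" using C(3) y z by (auto simp: pairwise_def orthogonal_def)
    have yy: "y \<bullet> y = 1" "z \<bullet> z = 1" using C(2) y z by (simp_all add: dot_square_norm)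
    define w where "w = (1 / sqrt 2) *\<^sub>R (y + z)"
    have "w \<bullet> w = 1"
      by (simp add: w_def inner_simps yy yz inner_commute[of z y])
    then have w: "norm w = 1" "hip w x = 0"
      using C(2)[OF y] C(2)[OF z] by (simp_all add: norm_eq_sqrt_inner w_def)
    obtain \<mu> where "B *v w = \<mu> *\<^sub>R w" using eigen w by metis
    then have "(1 / sqrt 2) *\<^sub>R (B *v y + B *v z) = (1 / sqrt 2) *\<^sub>R (\<mu> *\<^sub>R (y + z))"
      by (simp add: w_def mv_scaleR_right mv_add_right)
    from arg_cong[OF this, of "\<lambda>v. sqrt 2 *\<^sub>R v"]
    have e: "B *v y + B *v z = \<mu> *\<^sub>R (y + z)" by simp
    have By: "B *v y = ((B *v y) \<bullet> y) *\<^sub>R y" and Bz: "B *v z = ((B *v z) \<bullet> z) *\<^sub>R z"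
      using eigen C(2) y z by blast+
    have "(B *v y + B *v z) \<bullet> y = (B *v y) \<bullet> y" "(B *v y + B *v z) \<bullet> z = (B *v z) \<bullet> z"
      by (subst By, subst Bz, simp add: inner_simps yy yz inner_commute[of z y])+
    then show ?thesis unfolding e by (simp add: inner_simps yy yz inner_commute[of z y])
  qed simp
  then obtain g where g: "\<And>y. y \<in> C \<Longrightarrow> (B *v y) \<bullet> y = g" by metis
  define \<alpha> where "\<alpha> = (B *v x) \<bullet> x"
  have B_eq: "B = g *\<^sub>R mat 1 + (\<alpha> - g) *\<^sub>R outer x"
  proof (rule matrix_eq[THEN iffD2], intro allI)
    fix v
    have Bx: "B *v x = \<alpha> *\<^sub>R x" unfolding \<alpha>_def by (rule eigen) (simp_all add: x)
    have Bs: "B *v (c *s x) = \<alpha> *\<^sub>R (c *s x)" for c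
      unfolding mv_scale_right Bx by (simp add: vec_eq_iff)
    have "B *v (v - hip v x *s x) = (\<Sum>y\<in>C. (v \<bullet> y) *\<^sub>R (B *v y))"
      unfolding C(4)[symmetric] by (simp add: linear_sum[OF linear_mv] mv_scaleR_right)
    also have "\<dots> = (\<Sum>y\<in>C. (v \<bullet> y) *\<^sub>R (g *\<^sub>R y))"
      using eigen C(2) g by (intro sum.cong) metis+
    also have "\<dots> = g *\<^sub>R (v - hip v x *s x)"
      unfolding C(4)[symmetric] by (simp add: scaleR_sum_right mult.commute)
    finally have "B *v v = g *\<^sub>R (v - hip v x *s x) + \<alpha> *\<^sub>R (hip v x *s x)"
      by (simp add: mv_diff_right Bs algebra_simps)
    then show "B *v v = (g *\<^sub>R mat 1 + (\<alpha> - g) *\<^sub>R outer x) *v v"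
      by (simp add: mv_add_left mv_scaleR_left algebra_simps)
  qed
  have mat1: "mat 1 \<bullet> (mat 1 :: 'a^'d^'d) = 2 * real n"
    using norm_mat1_squared[where 'a = 'a and 'n = 'd] card_d by (simp add: power2_norm_eq_inner)
  have "B \<bullet> mat 1 = (\<integral>\<omega>. 0 \<partial>M)" unfolding inner_B
    by (rule Bochner_Integration.integral_cong)
      (auto simp: T_def observed_alt refl_inner_mat1[OF P_Proj card_d])
  then have "0 = g * (2 * real n) + (\<alpha> - g) * 1"
    using outer_in_Proj[OF x] by (simp add: B_eq inner_add_left mat1 Proj_iff)
  then have g_eq: "g * (2 * real n - 1) = - \<alpha>" by (simp add: algebra_simps)
  have "\<alpha> = (\<integral>\<omega>. T \<omega> \<bullet> outer x \<partial>M)" by (simp add: \<alpha>_def inner_outer[symmetric] inner_B)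
  also have "\<dots> = (\<integral>\<omega>. \<bar>(S \<omega> *v x) \<bullet> x\<bar> \<partial>M)"
    by (simp add: T_def inner_outer inner_observed_self[OF x])
  finally have \<alpha>: "\<alpha> \<ge> 2 * (mu1 (beta_param TYPE('a)) n - 1 / 2)" using first_moment[OF x] by simp
  define c where "c = mu1 (beta_param TYPE('a)) n - 1 / 2"
  have n1: "2 * real n - 1 > 0" using n by simp
  have mu2: "mu2 (beta_param TYPE('a)) n = 1 / 2 - c / (2 * real n - 1)"
    by (simp add: mu2_def c_def mu1_def mult_ac)
  have "\<alpha> - g = \<alpha> * (1 + 1 / (2 * real n - 1))"
    using g_eq n1 by (simp add: field_simps)
  also have "\<dots> \<ge> 2 * c * (1 + 1 / (2 * real n - 1))"
    using \<alpha> n1 by (intro mult_right_mono) (auto simp: c_def)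
  also have "2 * c * (1 + 1 / (2 * real n - 1)) = 2 * (mu1 (beta_param TYPE('a)) n - mu2 (beta_param TYPE('a)) n)"
    unfolding mu2 by (simp add: c_def algebra_simps)
  finally have "\<alpha> - g \<ge> 2 * (mu1 (beta_param TYPE('a)) n - mu2 (beta_param TYPE('a)) n)" .
  with B_eq show thesis by (intro that[of g "\<alpha> - g"]) (simp_all add: B_def T_def)
qed

end

section \<open>Stability of the principal eigenspace\<close>

lemma outer_phase: "norm c = 1 \<Longrightarrow> outer (c *s y) = outer y"
proof -
  assume "norm c = 1"
  then have c: "c * conjugate c = 1" by (simp add: mult_conjugate)
  have "c * u * conjugate (c * v) = (c * conjugate c) * (u * conjugate v)" for u v
    by (simp add: conjugate_mult mult_ac)
  then show ?thesis by (simp add: vec_eq_iff outer_def c)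
qed

text \<open>
  The projection onto a line does not see the phase of the spanning vector. With the phase chosen
  so that the Hermitian form is real, the two lines behave as in a real plane.
\<close>

lemma align_phase:
  fixes x y :: "'a::real_or_complex^'d"
  assumes "norm y = 1"
  obtains z where "norm z = 1" "outer z = outer y" "hip x z = of_real (x \<bullet> z)"
proof (cases "hip x y = 0")
  case True
  with assms show thesis by (intro that[of y]) (auto simp: real_part_hip[symmetric])
next
  case False
  define c where "c = (1 / norm (hip x y)) *\<^sub>R hip x y"
  have c: "norm c = 1" using False by (simp add: c_def)
  have "hip x (c *s y) = (1 / norm (hip x y)) *\<^sub>R (hip x y * conjugate (hip x y))"
    by (simp add: c_def mult.commute)
  also have "\<dots> = of_real (norm (hip x y))"
    unfolding mult_conjugate using False by (simp add: scaleR_conv_of_real power2_eq_square)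
  finally have "hip x (c *s y) = of_real (norm (hip x y))" .
  then show thesis using c assms
    by (intro that[of "c *s y"]) (auto simp: norm_scale outer_phase real_part_hip[symmetric])
qed

text \<open>
  The difference \<open>E\<close> of the two projections satisfies \<open>E\<^sup>3 = (1 - \<langle>x, y\<rangle>\<^sup>2) E\<close>; for a Hermitian matrix this
  bounds the norm. The bound is the sine of the angle between the lines.
\<close>

lemma opnorm_outer_diff:
  assumes x: "norm x = 1" and y: "norm y = 1" and c: "hip x y = of_real (x \<bullet> y)"
  shows "opnorm (outer x - outer y) \<le> sqrt (1 - (x \<bullet> y)\<^sup>2)"
proof -
  define c where "c = x \<bullet> y"
  define E where "E = outer x - outer y"
  have yx: "hip y x = of_real c" using c by (metis c_def conjugate_hip conjugate_of_real)
  have c1: "c\<^sup>2 \<le> 1" unfolding c_def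
    using Cauchy_Schwarz_ineq2[of x y] x y by (simp add: abs_square_le_1)
  have xy: "hip x y = of_real c" using c by (simp add: c_def)
  have herm: "ctranspose E = E" by (simp add: E_def)
  have E3: "E *v (E *v (E *v v)) = (1 - c\<^sup>2) *\<^sub>R (E *v v)" for v
  proof -
    have E: "E *v w = hip w x *s x - hip w y *s y" for w by (simp add: E_def mv_diff_left)
    show ?thesis unfolding E vec_eq_iff vector_scaleR_component
      by (simp add: hip_self x y xy yx algebra_simps scaleR_conv_of_real power2_eq_square)
  qed
  define s where "s = sqrt (1 - c\<^sup>2)"
  have s: "s \<ge> 0" "s\<^sup>2 = 1 - c\<^sup>2" using c1 by (simp_all add: s_def)
  have "norm (E *v v) \<le> s * norm v" for v
  proof -
    have "(norm (E *v (E *v v)))\<^sup>2 = (E *v (E *v (E *v v))) \<bullet> (E *v v)"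
      by (simp only: power2_norm_eq_inner) (subst (2) inner_mv_left, simp add: herm inner_commute)
    also have "\<dots> = (s * norm (E *v v))\<^sup>2"
      by (simp add: E3 s power_mult_distrib power2_norm_eq_inner)
    finally have 1: "norm (E *v (E *v v)) = s * norm (E *v v)"
      using s by (simp add: power2_eq_iff_nonneg)
    have "(norm (E *v v))\<^sup>2 = (E *v (E *v v)) \<bullet> v"
      by (simp only: power2_norm_eq_inner) (subst inner_mv_left, simp add: herm inner_commute)
    also have "\<dots> \<le> s * norm (E *v v) * norm v"
      using norm_cauchy_schwarz[of "E *v (E *v v)" v] by (simp add: 1)
    finally have "norm (E *v v) * norm (E *v v) \<le> norm (E *v v) * (s * norm v)"
      by (simp add: power2_eq_square mult_ac)
    then show ?thesis using s by (cases "norm (E *v v) = 0") (auto simp: mult_le_cancel_left)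
  qed
  then show ?thesis unfolding opnorm_def E_def[symmetric] s_def[symmetric] c_def[symmetric]
    by (intro onorm_bound s)
qed

text \<open>
  By symmetry, \<open>\<langle>Z y, y\<rangle> - \<langle>Z x, x\<rangle> = \<langle>Z (y - x), y + x\<rangle>\<close>, and the norms of \<open>y - x\<close> and \<open>y + x\<close> multiply to twice
  the sine of the angle.
\<close>

lemma inner_symmetric_outer_diff:
  assumes herm: "ctranspose Z = Z" and z: "\<And>v. norm v = 1 \<Longrightarrow> norm (Z *v v) \<le> z" "z \<ge> 0"
    and x: "norm x = 1" and y: "norm y = 1"
  shows "Z \<bullet> (outer y - outer x) \<le> 2 * z * sqrt (1 - (x \<bullet> y)\<^sup>2)"
proof -
  have z': "norm (Z *v v) \<le> z * norm v" for v
  proof (cases "v = 0")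
    case False
    then have "norm (Z *v ((1 / norm v) *\<^sub>R v)) \<le> z" by (intro z) simp
    then show ?thesis using False by (simp add: mv_scaleR_right field_simps)
  qed simp
  have sym: "(Z *v y) \<bullet> x = (Z *v x) \<bullet> y" by (metis inner_mv_left herm inner_commute)
  have unit: "x \<bullet> x = 1" "y \<bullet> y = 1" using x y by (simp_all add: dot_square_norm)
  have n: "(norm (y - x))\<^sup>2 = 2 - 2 * (x \<bullet> y)" "(norm (y + x))\<^sup>2 = 2 + 2 * (x \<bullet> y)"
    unfolding power2_norm_eq_inner
    by (simp_all add: inner_simps inner_commute[of y x] unit)
  have "(norm (y - x) * norm (y + x))\<^sup>2 = (2 - 2 * (x \<bullet> y)) * (2 + 2 * (x \<bullet> y))"
    by (simp only: power_mult_distrib n)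
  also have "\<dots> = 4 * (1 - (x \<bullet> y)\<^sup>2)"
    by (simp add: power2_eq_square algebra_simps)
  finally have "norm (y - x) * norm (y + x) = sqrt (4 * (1 - (x \<bullet> y)\<^sup>2))"
    by (metis abs_of_nonneg norm_ge_zero mult_nonneg_nonneg real_sqrt_abs)
  also have "\<dots> = 2 * sqrt (1 - (x \<bullet> y)\<^sup>2)" by (simp only: real_sqrt_mult real_sqrt_four)
  finally have N: "norm (y - x) * norm (y + x) = 2 * sqrt (1 - (x \<bullet> y)\<^sup>2)" .
  have "Z \<bullet> (outer y - outer x) = (Z *v (y - x)) \<bullet> (y + x)"
    by (simp add: inner_diff_right inner_outer mv_diff_right inner_simps sym)
  also have "\<dots> \<le> norm (Z *v (y - x)) * norm (y + x)" by (rule norm_cauchy_schwarz)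
  also have "\<dots> \<le> z * norm (y - x) * norm (y + x)" by (intro mult_right_mono z') simp
  also have "\<dots> = 2 * z * sqrt (1 - (x \<bullet> y)\<^sup>2)" using N by (simp add: mult_ac)
  finally show ?thesis .
qed

text \<open>
  Let \<open>s\<close> be the sine of the angle between the two lines. The multiple of the identity does not
  distinguish rank one projections, so optimality of \<open>Y\<close> reads \<open>d s\<^sup>2 \<le> tr Z (Y - X)\<close>, and the right-hand side
  is at most \<open>2 \<parallel>Z\<parallel> s\<close>.
\<close>

lemma opnorm_less_if_better_than_outer:
  fixes A :: "'a::real_or_complex^'d^'d"
  assumes x: "norm x = 1" and Y: "Y \<in> Proj 1"
    and opt: "A \<bullet> outer x \<le> A \<bullet> Y"
    and A: "A = Z + g *\<^sub>R mat 1 + d *\<^sub>R outer x"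
    and herm: "ctranspose Z = Z" and z: "\<And>v. norm v = 1 \<Longrightarrow> norm (Z *v v) < z"
    and d: "2 * z \<le> d * \<delta>" "d > 0"
  shows "opnorm (Y - outer x) < \<delta>"
proof -
  obtain y0 where "norm y0 = 1" "Y = outer y0" using rank_one_projection[OF Y] by blast
  with align_phase[of y0 x] obtain y where y: "norm y = 1" "Y = outer y"
    and c: "hip x y = of_real (x \<bullet> y)" by metis
  define s where "s = sqrt (1 - (x \<bullet> y)\<^sup>2)"
  have "\<bar>x \<bullet> y\<bar> \<le> 1" using Cauchy_Schwarz_ineq2[of x y] x y by simp
  then have s: "s \<ge> 0" "s\<^sup>2 = 1 - (x \<bullet> y)\<^sup>2" by (simp_all add: s_def abs_square_le_1)
  have zx: "0 \<le> norm (Z *v x)" "norm (Z *v x) < z" using z[OF x] by simp_all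
  then have \<delta>: "\<delta> > 0" using d by (smt (verit) mult_nonneg_nonpos)
  have one: "mat 1 \<bullet> outer v = 1" if "norm v = 1" for v :: "'a^'d"
    using that by (simp add: inner_outer dot_square_norm)
  have xy: "outer x \<bullet> outer y = (x \<bullet> y)\<^sup>2"
  proof -
    have "hip y x = of_real (x \<bullet> y)" using c by (metis conjugate_hip conjugate_of_real)
    then show ?thesis by (simp add: inner_outer scale_of_real power2_eq_square)
  qed
  have xx: "outer x \<bullet> outer x = 1" by (subst inner_outer) (simp add: x hip_self dot_square_norm)
  have "0 \<le> A \<bullet> (outer y - outer x)" using opt by (simp add: y inner_diff_right)
  also have "\<dots> = Z \<bullet> (outer y - outer x) - d * s\<^sup>2"
    by (simp add: A inner_add_left inner_diff_right one x y xx xy s algebra_simps)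
  finally have key: "d * s\<^sup>2 \<le> Z \<bullet> (outer y - outer x)" by simp
  have "s < \<delta>"
  proof (cases "s = 0")
    case False
    \<comment> \<open>the norm of \<open>Z\<close> is attained on the unit sphere, so the strict bound at each unit vector is uniform\<close>
    obtain z' where z': "z' < z" "z' \<ge> 0" "Z \<bullet> (outer y - outer x) \<le> 2 * z' * s"
    proof -
      have "compact (sphere (0::'a^'d) 1)" by (rule compact_sphere)
      moreover have "continuous_on (sphere 0 1) (\<lambda>v. norm (Z *v v))"
        unfolding matrix_vector_mult_def by (intro continuous_intros)
      moreover have "x \<in> sphere 0 1" using x by simp
      ultimately obtain v where v: "v \<in> sphere 0 1"
        "\<And>w. w \<in> sphere 0 1 \<Longrightarrow> norm (Z *v w) \<le> norm (Z *v v)"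
        using continuous_attains_sup[of "sphere (0::'a^'d) 1" "\<lambda>v. norm (Z *v v)"] by blast
      show thesis
      proof (rule that)
        show "norm (Z *v v) < z" using v(1) by (intro z) simp
        show "Z \<bullet> (outer y - outer x) \<le> 2 * norm (Z *v v) * s" unfolding s_def
          by (rule inner_symmetric_outer_diff[OF herm _ _ x y(1)]) (use v in auto)
      qed simp
    qed
    have pos: "s > 0" using False s by simp
    have "(d * s) * s \<le> (2 * z') * s" using key z' by (simp add: power2_eq_square mult_ac)
    then have "d * s \<le> 2 * z'" using pos by simp
    also have "\<dots> < d * \<delta>" using d z' by simp
    finally show ?thesis using d by simp
  qed (use \<delta> in simp)
  moreover have "opnorm (outer y - outer x) \<le> s"
    using opnorm_outer_diff[of y x] x y c conjugate_hip[of x y] unfolding s_def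
    by (metis conjugate_of_real inner_commute)
  ultimately show ?thesis by (simp add: y)
qed

lemma outer_feasible:
  assumes "norm x = 1"
  shows "pep_feasible (outer x)"
proof -
  have "(outer x *v v) \<bullet> v = (norm (hip v x))\<^sup>2" for v
  proof -
    have "(outer x *v v) \<bullet> v = real_part (hip v x * conjugate (hip v x))"
      by (simp add: real_part_hip[symmetric] conjugate_hip)
    then show ?thesis by (simp only: mult_conjugate real_part_of_real)
  qed
  then show ?thesis using outer_in_Proj[OF assms]
    by (auto simp: pep_feasible_def psd_def Proj_iff matrix_inner_self)
qed

text \<open>
  Since \<open>X\<close> is feasible, a solution does at least as well as \<open>X\<close>. Passing from the selected projections
  to the reflections adds the same amount on both sides.
\<close>

lemma pep_solution_observed:
  assumes sol: "pep_solution m Q (Phi Q (outer x)) Y" and x: "norm x = 1" and m: "m \<ge> 1"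
  shows "Y \<in> Proj 1"
    and "(\<Sum>j=1..m. observed (outer x) (Q j)) \<bullet> outer x \<le> (\<Sum>j=1..m. observed (outer x) (Q j)) \<bullet> Y"
proof -
  define R where "R j = (if phi (Q j) (outer x) = 1 then Q j else mat 1 - Q j)" for j
  define B where "B = (\<Sum>j=1..m. R j)"
  show Y: "Y \<in> Proj 1" using sol by (simp add: pep_solution_def)
  have pm: "pep_matrix m Q (Phi Q (outer x)) = (1 / real m) *\<^sub>R B"
    by (simp only: pep_matrix_def Phi_def B_def R_def)
  have "real_part (trace (((1 / real m) *\<^sub>R B) ** outer x)) \<le> real_part (trace (((1 / real m) *\<^sub>R B) ** Y))"
    using sol outer_feasible[OF x] unfolding pep_solution_def pep_optimal_def pm by blast
  moreover have "ctranspose Y = Y" using Y by (simp add: Proj_iff)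
  ultimately have B: "B \<bullet> outer x \<le> B \<bullet> Y"
    using m by (simp add: real_part_trace_mult divide_simps)
  have "observed (outer x) (Q j) = R j - (mat 1 - R j)" for j
    by (simp only: observed_def refl_def R_def)
  then have "(\<Sum>j=1..m. observed (outer x) (Q j)) = B - (real m *\<^sub>R mat 1 - B)"
    by (simp only: sum_subtractf B_def sum_constant_scaleR card_atLeastAtMost diff_Suc_1)
  moreover have "mat 1 \<bullet> outer x = mat 1 \<bullet> Y"
    using Y outer_in_Proj[OF x] by (simp add: Proj_iff inner_commute)
  ultimately show "(\<Sum>j=1..m. observed (outer x) (Q j)) \<bullet> outer x \<le> (\<Sum>j=1..m. observed (outer x) (Q j)) \<bullet> Y"
    using B by (simp only: inner_diff_left inner_scaleR_left)
qed

section \<open>Recovery from binary measurements\<close>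

lemma mu_gap_pos:
  assumes "\<beta> > 0" "n \<ge> 1"
  shows "mu1 \<beta> n - mu2 \<beta> n > 0"
proof -
  have a: "\<beta> * real n > 0" using assms by simp
  have "Beta (\<beta> * n) (\<beta> * n) > 0"
    unfolding Beta_def using assms by (intro divide_pos_pos mult_pos_pos Gamma_real_pos) auto
  then have "\<beta> * n * 4 powr (\<beta> * n) * Beta (\<beta> * n) (\<beta> * n) > 0"
    and "\<beta> * n * (2 * real n - 1) * 4 powr (\<beta> * n) * Beta (\<beta> * n) (\<beta> * n) > 0"
    using a assms(2) by auto
  then show ?thesis unfolding mu1_def mu2_def by (simp add: add_pos_pos)
qed

theorem theorem2p3p3:
  fixes n m :: nat
    and X :: "'a::real_or_complex^'d^'d"
    and \<delta> D :: real
    and M :: "'w measure"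
    and P :: "nat \<Rightarrow> 'w \<Rightarrow> 'a^'d^'d"
    and Xhat :: "'w \<Rightarrow> 'a^'d^'d"
  defines "\<mu>\<^sub>1 \<equiv> mu1 (beta_param TYPE('a)) n"
    and "\<mu>\<^sub>2 \<equiv> mu2 (beta_param TYPE('a)) n"
  assumes "n \<ge> 1" and "CARD('d) = 2 * n"
    and "X \<in> Proj 1"
    and "\<delta> > 0"
    and "m \<ge> 1"
    and "real m \<ge> 14 / 3 * (\<mu>\<^sub>1 - \<mu>\<^sub>2) powi (-2) * \<delta> powi (-2) * (ln (4 * real n) + D)"
    and "prob_space M"
    and "prob_space.indep_vars M (\<lambda>_. proj_space n) P {1..m}"
    and "\<And>j. j \<in> {1..m} \<Longrightarrow> uniform_proj_measure n (distr M (proj_space n) (P j))"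
    and "\<And>\<omega>. \<omega> \<in> space M \<Longrightarrow>
           pep_solution m (\<lambda>j. P j \<omega>) (Phi (\<lambda>j. P j \<omega>) X) (Xhat \<omega>)"
  shows "\<exists>E \<in> sets M. E \<subseteq> {\<omega> \<in> space M. opnorm (Xhat \<omega> - X) < \<delta>} \<and>
           measure M E \<ge> 1 - exp (- D)"
proof -
  interpret prob_space M by fact
  obtain x where x: "norm x = 1" "X = outer x" using rank_one_projection[OF \<open>X \<in> Proj 1\<close>] .
  define \<Delta> where "\<Delta> = \<mu>\<^sub>1 - \<mu>\<^sub>2"
  have \<Delta>: "\<Delta> > 0"
    unfolding \<Delta>_def \<mu>\<^sub>1_def \<mu>\<^sub>2_def using \<open>n \<ge> 1\<close> by (intro mu_gap_pos) (simp_all add: beta_param_def)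
  have loc: "uniform_projection M n (P j)" if "j \<in> {1..m}" for j
    using assms(3,4) assms(10,11) that by unfold_locales (auto simp: indep_vars_def)
  define T where "T j \<omega> = observed X (P j \<omega>)" for j \<omega>
  define B where "B j = (\<integral>\<omega>. T j \<omega> \<partial>M)" for j
  have "\<exists>g d. B j = g *\<^sub>R mat 1 + d *\<^sub>R X \<and> d \<ge> 2 * \<Delta>" if "j \<in> {1..m}" for j
    using uniform_projection.mean_observed[OF loc[OF that] x(1)]
    unfolding B_def T_def x(2) \<Delta>_def \<mu>\<^sub>1_def \<mu>\<^sub>2_def by metis
  then obtain g d where gd: "\<And>j. j \<in> {1..m} \<Longrightarrow> B j = g j *\<^sub>R mat 1 + d j *\<^sub>R X \<and> d j \<ge> 2 * \<Delta>"
    by metis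
  have T: "ctranspose (T j \<omega>) = T j \<omega>" "norm (T j \<omega> *v v) = norm v"
      "norm (T j \<omega>) = norm (mat 1 :: 'a^'d^'d)"
    if "j \<in> {1..m}" "\<omega> \<in> space M" for j \<omega> v
    unfolding T_def by (intro observed_reflection uniform_projection.P_hermitian_idempotent[OF loc] that)+
  define Y where "Y j \<omega> = T j \<omega> - B j" for j \<omega>
  define K where "K = norm (mat 1 :: 'a^'d^'d) + (\<Sum>j=1..m. norm (B j))"
  define s where "s = real m * \<Delta> * \<delta>"
  have "\<exists>E\<in>events. E \<subseteq> {\<omega> \<in> space M. \<forall>v. norm v = 1 \<longrightarrow> norm ((\<Sum>j\<in>{1..m}. Y j \<omega>) *v v) < s} \<and>
      prob E \<ge> 1 - 2 * CARD('d) * exp (- s\<^sup>2 / (4 * card {1..m}))"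
  proof (rule matrix_concentration[where K = K])
    have obs: "(\<lambda>Q. observed X Q - B j) \<in> borel_measurable (proj_space n)" for j
      unfolding proj_space_def x(2) by (intro measurable_restrict_space1) measurable
    show "indep_vars (\<lambda>_. borel) Y {1..m}"
      unfolding Y_def T_def by (rule indep_vars_compose2[OF assms(10)]) (rule obs)
    show "s > 0" using \<Delta> \<open>\<delta> > 0\<close> \<open>m \<ge> 1\<close> by (simp add: s_def)
    fix j assume j: "j \<in> {1..m}"
    interpret U: uniform_projection M n "P j" by (rule loc[OF j])
    have meas: "T j \<in> borel_measurable M" unfolding T_def x(2) by measurable
    have int: "integrable M (T j)"
      by (rule integrable_bounded[OF meas, where K = "norm (mat 1 :: 'a^'d^'d)"]) (use T j in auto)
    show "(\<integral>\<omega>. Y j \<omega> \<partial>M) = 0"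
      unfolding Y_def using int by (simp add: B_def prob_space)
    fix \<omega> assume w: "\<omega> \<in> space M"
    have "ctranspose (B j) = B j" using gd[OF j] by (simp add: x(2))
    then show "ctranspose (Y j \<omega>) = Y j \<omega>" by (simp add: Y_def T(1)[OF j w])
    have "norm (B j) \<le> (\<Sum>j=1..m. norm (B j))" using j by (intro member_le_sum) auto
    then show "norm (Y j \<omega>) \<le> K"
      unfolding Y_def K_def using norm_triangle_ineq4[of "T j \<omega>" "B j"] T(3)[OF j w] by linarith
    fix \<omega>' v assume w': "\<omega>' \<in> space M"
    have "norm ((Y j \<omega> - Y j \<omega>') *v v) \<le> norm (T j \<omega> *v v) + norm (T j \<omega>' *v v)"
      unfolding Y_def by (simp add: mv_diff_left norm_triangle_ineq4)
    then show "norm ((Y j \<omega> - Y j \<omega>') *v v) \<le> 2 * norm v"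
      by (simp add: T(2)[OF j w] T(2)[OF j w'])
  qed (use \<open>m \<ge> 1\<close> in auto)
  then obtain E where E: "E \<in> events" "prob E \<ge> 1 - 2 * CARD('d) * exp (- s\<^sup>2 / (4 * real m))"
    and E_sub: "\<And>\<omega> v. \<omega> \<in> E \<Longrightarrow> \<omega> \<in> space M \<and> (norm v = 1 \<longrightarrow> norm ((\<Sum>j=1..m. Y j \<omega>) *v v) < s)"
    by auto
  have "2 * CARD('d) * exp (- s\<^sup>2 / (4 * real m)) \<le> exp (- D)"
  proof -
    define L where "L = ln (4 * real n) + D"
    have "14 / 3 * L \<le> real m * (\<Delta>\<^sup>2 * \<delta>\<^sup>2)"
      using assms(8) \<Delta> \<open>\<delta> > 0\<close> unfolding \<Delta>_def[symmetric] L_def[symmetric]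
      by (simp add: power_int_minus field_simps)
    moreover have "0 \<le> real m * (\<Delta>\<^sup>2 * \<delta>\<^sup>2)" by simp
    ultimately have "L \<le> real m * (\<Delta>\<^sup>2 * \<delta>\<^sup>2) / 4" by linarith
    also have "\<dots> = s\<^sup>2 / (4 * real m)"
      using \<open>m \<ge> 1\<close> by (simp add: s_def power2_eq_square field_simps)
    finally have "exp (ln (4 * real n) + - s\<^sup>2 / (4 * real m)) \<le> exp (- D)"
      unfolding exp_le_cancel_iff L_def by simp
    also have "exp (ln (4 * real n) + - s\<^sup>2 / (4 * real m)) = 2 * CARD('d) * exp (- s\<^sup>2 / (4 * real m))"
      unfolding exp_add assms(4) using \<open>n \<ge> 1\<close> by simp
    finally show ?thesis .
  qed
  then have "prob E \<ge> 1 - exp (- D)" using E(2) by simp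
  moreover have "opnorm (Xhat \<omega> - X) < \<delta>" if w: "\<omega> \<in> E" for \<omega>
  proof -
    have wM: "\<omega> \<in> space M" using E_sub[OF w] by blast
    have sol: "pep_solution m (\<lambda>j. P j \<omega>) (Phi (\<lambda>j. P j \<omega>) (outer x)) (Xhat \<omega>)"
      using assms(12)[OF wM] by (simp add: x(2))
    note opt = pep_solution_observed[OF sol x(1) \<open>m \<ge> 1\<close>]
    show ?thesis unfolding x(2)
    proof (rule opnorm_less_if_better_than_outer[OF x(1) opt])
      have "(\<Sum>j=1..m. B j) = (\<Sum>j=1..m. g j *\<^sub>R mat 1 + d j *\<^sub>R X)"
        using gd by (intro sum.cong) auto
      then show "(\<Sum>j=1..m. observed (outer x) (P j \<omega>)) =
          (\<Sum>j=1..m. Y j \<omega>) + (\<Sum>j=1..m. g j) *\<^sub>R mat 1 + (\<Sum>j=1..m. d j) *\<^sub>R outer x"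
        unfolding Y_def T_def x(2) sum_subtractf scaleR_sum_left by (simp add: sum.distrib)
      have "ctranspose (Y j \<omega>) = Y j \<omega>" if "j \<in> {1..m}" for j
        using gd[OF that] by (simp add: Y_def T(1)[OF that wM] x(2))
      then show "ctranspose (\<Sum>j=1..m. Y j \<omega>) = (\<Sum>j=1..m. Y j \<omega>)"
        unfolding ctranspose_sum by (intro sum.cong) auto
      show "norm ((\<Sum>j=1..m. Y j \<omega>) *v v) < s" if "norm v = 1" for v
        using E_sub[OF w] that by blast
      have d: "2 * (real m * \<Delta>) \<le> (\<Sum>j=1..m. d j)"
        using sum_mono[of "{1..m}" "\<lambda>_. 2 * \<Delta>" d] gd by (simp add: mult_ac)
      have pos: "0 < real m * \<Delta>" using \<Delta> \<open>m \<ge> 1\<close> by simp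
      show "0 < (\<Sum>j=1..m. d j)" using d pos by linarith
      show "2 * s \<le> (\<Sum>j=1..m. d j) * \<delta>"
        using mult_right_mono[OF d, of \<delta>] \<open>\<delta> > 0\<close> by (simp add: s_def mult_ac)
    qed
  qed
  ultimately show ?thesis using E(1) E_sub by (intro bexI[of _ E]) auto
qed

end
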